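(* Let $\alpha,\beta>-1$, let $\mu\ge1$ be an integer, let $\gamma\in\mathbb R$ with $\alpha+\gamma>-1$, let $g\in C^\infty[-1,1]$, and let $f(x)=(1-x)^{\gamma}\ln^{\mu}(1-x)\,g(x)$. Then the Jacobi coefficients of $f$ satisfy, as $n\to\infty$, $$|a_n(\alpha,\beta)|=\begin{cases}O\big(n^{-\alpha-2\gamma-1}\ln^{\mu}(n)\big), & \gamma \text{ is not an integer},\\ O\big(n^{-\alpha-2\gamma-1}\ln^{\mu-1}(n)\big), & \gamma\text{ is an integer}.\end{cases}$$
   Context: For $\alpha,\beta>-1$, $P_n^{(\alpha,\beta)}$ is the Jacobi polynomial of degree $n$ (standard normalization), $\sigma_n^{\alpha,\beta}=\int_{-1}^1(1-x)^\alpha(1+x)^\beta [P_n^{(\alpha,\beta)}(x)]^2\,dx$, and the Jacobi coefficients of $f$ are $$a_n(\alpha,\beta)=\frac{1}{\sigma_n^{\alpha,\beta}}\int_{-1}^{1}(1-x)^{\alpha}(1+x)^{\beta}f(x)P_n^{(\alpha,\beta)}(x)\,dx.$$ The constants in the $O$-terms may depend on everything except $n$.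
   Formalization: The bound with ln^(μ-1)(n) is asserted only for integers γ ≥ 0; for negative integers γ the bound is with ln^μ(n), since the stated one fails there (e.g. α=1, β=0, γ=-1, μ=1, g=1 gives a_n = ln 2 − H_n − H_{n+1}). *)

theory Defs
  imports "HOL-Analysis.Analysis" "HOL-Library.Landau_Symbols"
begin

text \<open>Jacobi polynomials in the standard normalization, i.e. with value
  \<open>(n + \<alpha>) gchoose n\<close> at 1.  This is the expansion of the Rodrigues formula
  \<open>P\<^sub>n(x) = (-1)^n / (2^n n!) (1-x)^(-\<alpha>) (1+x)^(-\<beta>) (d/dx)^n ((1-x)^(\<alpha>+n) (1+x)^(\<beta>+n))\<close>
  by the Leibniz rule; unlike the expansions in powers of \<open>1 - x\<close> with Gamma factors, it needs
  no special case at \<open>\<alpha> + \<beta> = -1\<close>.\<close>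

definition jacobi_poly :: "real \<Rightarrow> real \<Rightarrow> nat \<Rightarrow> real \<Rightarrow> real" where
  "jacobi_poly \<alpha> \<beta> n x =
     (\<Sum>s\<le>n. ((real n + \<alpha>) gchoose (n - s)) * ((real n + \<beta>) gchoose s) *
            ((x - 1) / 2) ^ s * ((x + 1) / 2) ^ (n - s))"

lemma jacobi_poly_at_1: "jacobi_poly \<alpha> \<beta> n 1 = (real n + \<alpha>) gchoose n"
  by (simp add: jacobi_poly_def power_0_left if_distrib if_distribR cong: if_cong)

definition jacobi_weight :: "real \<Rightarrow> real \<Rightarrow> real \<Rightarrow> real" where
  "jacobi_weight \<alpha> \<beta> x = (1 - x) powr \<alpha> * (1 + x) powr \<beta>"

definition jacobi_sigma :: "real \<Rightarrow> real \<Rightarrow> nat \<Rightarrow> real" where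
  "jacobi_sigma \<alpha> \<beta> n = (LBINT x:{-1..1}. jacobi_weight \<alpha> \<beta> x * (jacobi_poly \<alpha> \<beta> n x)\<^sup>2)"

definition jacobi_coeff :: "real \<Rightarrow> real \<Rightarrow> (real \<Rightarrow> real) \<Rightarrow> nat \<Rightarrow> real" where
  "jacobi_coeff \<alpha> \<beta> f n =
     1 / jacobi_sigma \<alpha> \<beta> n *
     (LBINT x:{-1..1}. jacobi_weight \<alpha> \<beta> x * f x * jacobi_poly \<alpha> \<beta> n x)"

text \<open>Membership in \<open>C\<^sup>\<infinity>(S)\<close> for a nondegenerate interval \<open>S\<close>: \<open>D k\<close> is the \<open>k\<close>-th derivative
  of \<open>g\<close> on \<open>S\<close>, one-sided at endpoints belonging to \<open>S\<close>.  Values of \<open>g\<close> outside \<open>S\<close> are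
  irrelevant.\<close>

definition C_infinity_on :: "real set \<Rightarrow> (real \<Rightarrow> real) \<Rightarrow> bool" where
  "C_infinity_on S g \<longleftrightarrow>
     (\<exists>D :: nat \<Rightarrow> real \<Rightarrow> real. (\<forall>x\<in>S. D 0 x = g x) \<and>
        (\<forall>k. \<forall>x\<in>S. (D k has_real_derivative D (Suc k) x) (at x within S)))"

end

theory Submission
  imports Defs "HOL-Computational_Algebra.Polynomial" "HOL-Real_Asymp.Real_Asymp"
begin

text \<open>Taylor expansion of \<open>g\<close> at \<open>1\<close> reduces the claim to the moments of
  \<open>(1-x)^(\<gamma>+i) ln(1-x)^\<mu>\<close> and of a remainder that vanishes to high order at \<open>1\<close>.  Integrating by
  parts \<open>m\<close> times moves the weight to \<open>(\<alpha>+m, \<beta>+m)\<close>, lowers the degree of the Jacobi polynomial by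
  \<open>m\<close> and gains the factor \<open>(n-m)!/(2^m n!)\<close>.  For the remainder a fixed large \<open>m\<close> suffices, as
  \<open>\<sigma>\<^sub>n\<close> is of exact order \<open>1/n\<close>.  For the logarithmic terms take \<open>m = n\<close>: the \<open>n\<close>-th derivative is
  \<open>(1-x)^(\<gamma>-n) q\<^sub>n(ln(1-x))\<close> with \<open>q\<^sub>n = (\<Prod>k<n. k - \<gamma> - D) u^\<mu>\<close>, where \<open>D = d/du\<close>.  In the coefficient
  norm with weight \<open>R = ln n\<close> the operator \<open>D\<close> has norm at most \<open>\<mu>/R\<close> on degree \<open>\<le> \<mu>\<close>, so
  \<open>q\<^sub>n\<close> has norm at most \<open>R^\<mu> (\<Prod>k<n. \<bar>k - \<gamma>\<bar> + \<mu>/R) = O(R^\<mu> n! n^(-\<gamma>-1))\<close>; if \<open>\<gamma>\<close> is a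
  nonnegative integer, the factor \<open>k = \<gamma>\<close> equals \<open>\<mu>/R\<close> and saves one logarithm.\<close>

section \<open>Integrals against the Jacobi weight\<close>

lemma jacobi_weight_nonneg: "jacobi_weight a b x \<ge> 0"
  by (simp add: jacobi_weight_def)

text \<open>With t = (1 - x) / 2 the weight becomes 2^(a+b) t^a (1-t)^b, so both claims reduce to
  the Beta integral. \<open>F\<close> carries the indicator of the unit interval because the affine
  substitution rule is stated for the whole line.\<close>

lemma jacobi_weight_integral:
  assumes "a > -1" "b > -1"
  shows jacobi_weight_integrable: "set_integrable lborel {-1<..<1} (jacobi_weight a b)"
    and jacobi_weight_integral_eq:
      "(LBINT x:{-1<..<1}. jacobi_weight a b x) = 2 powr (a + b + 1) * Beta (a + 1) (b + 1)"
proof -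
  define F where "F t = indicat_real {0<..<1} t *\<^sub>R (t powr a * (1 - t) powr b)" for t
  have Beta: "set_integrable lborel {0..1} (\<lambda>t. t powr a * (1 - t) powr b)"
    using integrable_Beta[of "a + 1" "b + 1"] assms by simp
  then have "set_integrable lborel {0<..<1} (\<lambda>t. t powr a * (1 - t) powr b)"
    by (rule set_integrable_subset) auto
  then have F: "integrable lborel F"
    unfolding set_integrable_def F_def[abs_def] .
  have "((\<lambda>t. t powr a * (1 - t) powr b) has_integral Beta (a + 1) (b + 1)) {0..1}"
    using has_integral_Beta_real[of "a + 1" "b + 1"] assms by simp
  then have "(LBINT t:{0..1}. t powr a * (1 - t) powr b) = Beta (a + 1) (b + 1)"
    using set_borel_integral_eq_integral(2)[OF Beta] by (simp add: integral_unique)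
  moreover have "(LBINT t:{0..1}. t powr a * (1 - t) powr b) = integral\<^sup>L lborel F"
    unfolding set_lebesgue_integral_def F_def[abs_def]
    by (rule integral_discrete_difference[where X = "{0,1}"]) (auto split: split_indicator)
  ultimately have F_eq: "integral\<^sup>L lborel F = Beta (a + 1) (b + 1)"
    by simp
  have sub: "F (1/2 + (-1/2) * x) = 2 powr (- (a + b)) * (indicat_real {-1<..<1} x *\<^sub>R jacobi_weight a b x)" for x
  proof (cases "x \<in> {-1<..<1}")
    case True
    then have "1/2 + (-1/2) * x = (1 - x) / 2" "1 - (1/2 + (-1/2) * x) = (1 + x) / 2"
      by (auto simp: field_simps)
    then show ?thesis using True
      unfolding F_def jacobi_weight_def
      by (simp add: powr_divide powr_minus[of 2 "a + b"] powr_add[of 2 a b] field_simps del: minus_add_distrib)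
  next
    case False
    then have "1/2 + (-1/2) * x \<notin> {0<..<1}" by auto
    with False show ?thesis unfolding F_def by simp
  qed
  have "integrable lborel (\<lambda>x. F (1/2 + (-1/2) * x))"
    using F by (rule lborel_integrable_real_affine) simp
  then show "set_integrable lborel {-1<..<1} (jacobi_weight a b)"
    unfolding sub set_integrable_def by simp
  have "integral\<^sup>L lborel F = \<bar>-1/2\<bar> *\<^sub>R (\<integral>x. F (1/2 + (-1/2) * x) \<partial>lborel)"
    by (rule lborel_integral_real_affine) simp
  also have "\<dots> = 2 powr (- (a + b)) / 2 * (LBINT x:{-1<..<1}. jacobi_weight a b x)"
    unfolding sub set_lebesgue_integral_def by simp
  finally have "Beta (a + 1) (b + 1) = 2 powr (- (a + b)) / 2 * (LBINT x:{-1<..<1}. jacobi_weight a b x)"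
    by (simp only: F_eq)
  moreover have "2 powr (a + b + 1) * (2 powr (- (a + b)) / 2) = (1::real)"
    by (simp add: powr_add powr_minus field_simps flip: powr_add)
  ultimately show "(LBINT x:{-1<..<1}. jacobi_weight a b x) = 2 powr (a + b + 1) * Beta (a + 1) (b + 1)"
    by (metis mult.assoc mult_1)
qed

text \<open>The bound on \<open>h\<close> shifts the exponent at 1 from a to a + c, and the weight
  with the shifted exponent dominates. Since c may be negative, \<open>h\<close> is only asked to be
  continuous on the open interval.\<close>

lemma weighted_integrable:
  assumes "a + c > -1" "b > -1"
    and h: "continuous_on {-1<..<1} h" "\<And>x. x \<in> {-1<..<1} \<Longrightarrow> \<bar>h x\<bar> \<le> C * (1 - x) powr c"
    and p: "continuous_on {-1..1} p"
  shows "set_integrable lborel {-1<..<1} (\<lambda>x. jacobi_weight a b x * h x * p x)"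
proof -
  obtain B where B: "\<forall>x\<in>{-1..1}. \<bar>p x\<bar> \<le> B"
    using compact_imp_bounded[OF compact_continuous_image[OF p compact_Icc]]
    by (auto simp: bounded_iff)
  have "set_integrable lborel {-1<..<1} (\<lambda>x. C * B * jacobi_weight (a + c) b x)"
    using jacobi_weight_integrable[OF assms(1,2)] by simp
  then show ?thesis
  proof (rule set_integrable_bound)
    have "continuous_on {-1<..<1} p"
      using p by (rule continuous_on_subset) auto
    then have "continuous_on {-1<..<1} (\<lambda>x. jacobi_weight a b x * h x * p x)"
      unfolding jacobi_weight_def by (intro continuous_intros h) auto
    then show "set_borel_measurable lborel {-1<..<1} (\<lambda>x. jacobi_weight a b x * h x * p x)"
      unfolding set_borel_measurable_def
      by (simp add: borel_measurable_continuous_on_indicator del: real_scaleR_def)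
    show "AE x in lborel. x \<in> {-1<..<1} \<longrightarrow> norm (jacobi_weight a b x * h x * p x)
            \<le> norm (C * B * jacobi_weight (a + c) b x)"
    proof (intro AE_I2 impI)
      fix x :: real assume x: "x \<in> {-1<..<1}"
      have "norm (jacobi_weight a b x * h x * p x) = jacobi_weight a b x * \<bar>h x\<bar> * \<bar>p x\<bar>"
        by (simp add: abs_mult jacobi_weight_nonneg)
      also have "\<dots> \<le> jacobi_weight a b x * (C * (1 - x) powr c) * B"
        using h(2)[OF x] B x jacobi_weight_nonneg[of a b x]
        by (intro mult_mono mult_nonneg_nonneg order.trans[OF abs_ge_zero h(2)[OF x]]) auto
      also have "\<dots> = C * B * jacobi_weight (a + c) b x"
        by (simp add: jacobi_weight_def powr_add)
      finally show "norm (jacobi_weight a b x * h x * p x) \<le> norm (C * B * jacobi_weight (a + c) b x)"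
        by simp
    qed
  qed
qed

section \<open>Integration by parts\<close>

lemma continuous_on_jacobi_poly: "continuous_on S (jacobi_poly a b n)"
  unfolding jacobi_poly_def by (intro continuous_intros) auto

text \<open>Absorbing the weight leaves constants times real powers of 1 - x and 1 + x, which can be
  differentiated term by term.\<close>

lemma weighted_jacobi_poly_expand:
  assumes "x \<in> {-1<..<1}"
  shows "jacobi_weight a b x * jacobi_poly a b n x =
    (\<Sum>s\<le>n. (-1) ^ s / 2 ^ n * ((real n + a) gchoose (n - s)) * ((real n + b) gchoose s) *
       ((1 - x) powr (a + real s) * (1 + x) powr (b + real (n - s))))"
  unfolding jacobi_poly_def sum_distrib_left
proof (rule sum.cong[OF refl])
  fix s assume s: "s \<in> {..n}"
  have "(x - 1) ^ s = (-1) ^ s * (1 - x) ^ s"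
    by (metis minus_diff_eq mult_minus1 power_mult_distrib)
  moreover have "(2::real) ^ n = 2 ^ s * 2 ^ (n - s)"
    using s by (simp flip: power_add)
  ultimately show "jacobi_weight a b x * (((real n + a) gchoose (n - s)) * ((real n + b) gchoose s) *
      ((x - 1) / 2) ^ s * ((x + 1) / 2) ^ (n - s)) =
     (-1) ^ s / 2 ^ n * ((real n + a) gchoose (n - s)) * ((real n + b) gchoose s) *
       ((1 - x) powr (a + real s) * (1 + x) powr (b + real (n - s)))"
    using assms by (simp add: jacobi_weight_def powr_add powr_realpow power_divide add.commute)
qed

lemma gbinomial_Suc_absorb: "real (Suc k) * (x gchoose Suc k) = (x - real k) * (x gchoose k)"
  by (metis gbinomial_absorb_comp gbinomial_absorption gbinomial_factors mult.commute of_nat_Suc)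

text \<open>The one-step form of the Rodrigues formula, obtained by differentiating the expansion
  and collecting the coefficient of each \<open>e s\<close>. \<open>A\<close> and \<open>B\<close>
  serve both sides since n + (a + 1) = (n + 1) + a.\<close>

lemma jacobi_poly_shift_deriv:
  assumes x: "x \<in> {-1<..<1}"
  shows "((\<lambda>x. jacobi_weight (a + 1) (b + 1) x * jacobi_poly (a + 1) (b + 1) n x)
     has_real_derivative - 2 * real (Suc n) * (jacobi_weight a b x * jacobi_poly a b (Suc n) x)) (at x)"
proof -
  define A where "A i = ((real (Suc n) + a) gchoose i)" for i
  define B where "B i = ((real (Suc n) + b) gchoose i)" for i
  define e where "e s = (1 - x) powr (a + real s) * (1 + x) powr (b + real (Suc n - s))" for s
  define F where "F x = (\<Sum>s\<le>n. (-1) ^ s / 2 ^ n * A (n - s) * B s *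
       ((1 - x) powr (a + 1 + real s) * (1 + x) powr (b + 1 + real (n - s))))" for x
  have eqF: "jacobi_weight (a + 1) (b + 1) x * jacobi_poly (a + 1) (b + 1) n x = F x"
    if "x \<in> {-1<..<1}" for x
    unfolding weighted_jacobi_poly_expand[OF that] F_def A_def B_def
    by (simp add: add_ac)
  have "(F has_real_derivative
     (\<Sum>s\<le>n. (-1) ^ s / 2 ^ n * A (n - s) * B s *
        (- (a + 1 + real s) * e s + (b + 1 + real (n - s)) * e (Suc s)))) (at x)"
    unfolding F_def[abs_def]
  proof (rule DERIV_sum, rule DERIV_cmult)
    fix s assume "s \<in> {..n}"
    then have s: "Suc n - s = Suc (n - s)" by auto
    show "((\<lambda>x. (1 - x) powr (a + 1 + real s) * (1 + x) powr (b + 1 + real (n - s)))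
       has_real_derivative - (a + 1 + real s) * e s + (b + 1 + real (n - s)) * e (Suc s)) (at x)"
      unfolding e_def using x
      by (auto intro!: derivative_eq_intros simp: s algebra_simps)
  qed
  \<comment> \<open>Each term contributes to \<open>e s\<close> and to \<open>e (Suc s)\<close>. By
    absorption the factors a + 1 + s and b + 1 + (n - s) turn, after an index shift in the second
    sum, into n + 1 - s and s. These vanish at s = n + 1 and s = 0 respectively, so both sums extend
    to n + 1, and there the two factors add up to n + 1.\<close>
  also have "(\<Sum>s\<le>n. (-1) ^ s / 2 ^ n * A (n - s) * B s *
        (- (a + 1 + real s) * e s + (b + 1 + real (n - s)) * e (Suc s))) =
     (\<Sum>s\<le>Suc n. - ((-1) ^ s / 2 ^ n * (real (Suc n - s) * A (Suc n - s)) * B s * e s)) +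
     (\<Sum>s\<le>Suc n. - ((-1) ^ s / 2 ^ n * A (Suc n - s) * (real s * B s) * e s))"
  proof -
    have "(\<Sum>s\<le>Suc n. - ((-1) ^ s / 2 ^ n * (real (Suc n - s) * A (Suc n - s)) * B s * e s)) =
       (\<Sum>s\<le>n. - ((-1) ^ s / 2 ^ n * ((a + 1 + real s) * A (n - s)) * B s * e s))"
      (is "?l = sum ?r _")
    proof -
      have "real (Suc n - s) * A (Suc n - s) = (a + 1 + real s) * A (n - s)" if "s \<le> n" for s
        using gbinomial_Suc_absorb[of "n - s" "real (Suc n) + a"] that
        by (simp add: A_def Suc_diff_le of_nat_diff algebra_simps)
      then show ?thesis by simp
    qed
    moreover have "(\<Sum>s\<le>Suc n. - ((-1) ^ s / 2 ^ n * A (Suc n - s) * (real s * B s) * e s)) =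
       (\<Sum>s\<le>n. (-1) ^ s / 2 ^ n * A (n - s) * ((b + 1 + real (n - s)) * B s) * e (Suc s))"
    proof -
      have "real (Suc s) * B (Suc s) = (b + 1 + real (n - s)) * B s" if "s \<le> n" for s
        using gbinomial_Suc_absorb[of s "real (Suc n) + b"] that
        by (simp add: B_def of_nat_diff algebra_simps)
      then show ?thesis
        by (subst sum.atMost_Suc_shift) simp
    qed
    ultimately show ?thesis
      by (simp only: sum.distrib[symmetric]) (rule sum.cong, auto simp: field_simps)
  qed
  also have "\<dots> = - 2 * real (Suc n) * (jacobi_weight a b x * jacobi_poly a b (Suc n) x)"
    unfolding weighted_jacobi_poly_expand[OF x] sum_distrib_left sum.distrib[symmetric]
    by (rule sum.cong) (auto simp: A_def B_def e_def of_nat_diff field_simps)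
  finally show ?thesis
    by (rule has_field_derivative_transform_within_open[where S = "{-1<..<1}"])
       (use x eqF in auto)
qed

section \<open>Functions with a power-type singularity at 1, and integration by parts against
  them\<close>

text \<open>The whole sequence of derivatives is carried along so that integration by parts can be
  iterated. The model is (1 - x)^c times a function smooth up to both endpoints: each derivative
  costs one power of 1 - x at 1, whereas near -1 the bound only says that every derivative stays
  bounded.\<close>

definition endpoint_smooth :: "real \<Rightarrow> (nat \<Rightarrow> real \<Rightarrow> real) \<Rightarrow> bool" where
  "endpoint_smooth c H \<longleftrightarrow> (\<forall>k.
     (\<forall>x\<in>{-1<..<1}. (H k has_real_derivative H (Suc k) x) (at x)) \<and>
     (\<exists>C. \<forall>x\<in>{-1<..<1}. \<bar>H k x\<bar> \<le> C * (1 - x) powr (c - real k)))"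

lemma endpoint_smooth_deriv:
  "endpoint_smooth c H \<Longrightarrow> x \<in> {-1<..<1} \<Longrightarrow> (H k has_real_derivative H (Suc k) x) (at x)"
  by (auto simp: endpoint_smooth_def)

lemma endpoint_smooth_bound:
  assumes "endpoint_smooth c H"
  obtains C where "\<And>x. x \<in> {-1<..<1} \<Longrightarrow> \<bar>H k x\<bar> \<le> C * (1 - x) powr (c - real k)"
  using assms unfolding endpoint_smooth_def by blast

lemma endpoint_smooth_Suc:
  assumes "endpoint_smooth c H"
  shows "endpoint_smooth (c - 1) (\<lambda>k. H (Suc k))"
proof -
  have "\<exists>C. \<forall>x\<in>{-1<..<1}. \<bar>H (Suc k) x\<bar> \<le> C * (1 - x) powr (c - 1 - real k)" for k
    using assms unfolding endpoint_smooth_def by (metis diff_diff_eq of_nat_Suc)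
  then show ?thesis
    using assms unfolding endpoint_smooth_def by blast
qed

lemma endpoint_smooth_continuous:
  "endpoint_smooth c H \<Longrightarrow> continuous_on {-1<..<1} (H k)"
  by (meson DERIV_isCont continuous_at_imp_continuous_on endpoint_smooth_deriv)

lemma endpoint_smooth_weighted_integrable:
  assumes "a + c - real k > -1" "b > -1" "endpoint_smooth c H" "continuous_on {-1..1} p"
  shows "set_integrable lborel {-1<..<1} (\<lambda>x. jacobi_weight a b x * H k x * p x)"
proof -
  obtain C where "\<And>x. x \<in> {-1<..<1} \<Longrightarrow> \<bar>H k x\<bar> \<le> C * (1 - x) powr (c - real k)"
    using endpoint_smooth_bound[OF assms(3)] by blast
  then show ?thesis
    using assms endpoint_smooth_continuous by (intro weighted_integrable) auto
qed

text \<open>The product \<open>Q x * H 0 x\<close> has derivative \<open>v x - d * u x\<close> by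
  \<open>jacobi_poly_shift_deriv\<close> and tends to 0 at both endpoints, so the integral of this
  derivative is zero.\<close>

lemma jacobi_by_parts:
  assumes a: "a + c > -1" and b: "b > -1" and H: "endpoint_smooth c H"
  shows "(LBINT x:{-1<..<1}. jacobi_weight a b x * H 0 x * jacobi_poly a b (Suc n) x) =
     1 / (2 * real (Suc n)) *
     (LBINT x:{-1<..<1}. jacobi_weight (a + 1) (b + 1) x * H 1 x * jacobi_poly (a + 1) (b + 1) n x)"
proof -
  define Q where "Q x = jacobi_weight (a + 1) (b + 1) x * jacobi_poly (a + 1) (b + 1) n x" for x
  define u where "u x = jacobi_weight a b x * H 0 x * jacobi_poly a b (Suc n) x" for x
  define v where "v x = jacobi_weight (a + 1) (b + 1) x * H 1 x * jacobi_poly (a + 1) (b + 1) n x" for x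
  define d where "d = 2 * real (Suc n)"
  have intu: "set_integrable lborel {-1<..<1} u"
    unfolding u_def[abs_def] using a b H
    by (intro endpoint_smooth_weighted_integrable continuous_on_jacobi_poly) auto
  have intv: "set_integrable lborel {-1<..<1} v"
    unfolding v_def[abs_def] using a b H
    by (intro endpoint_smooth_weighted_integrable continuous_on_jacobi_poly) auto
  have int: "set_integrable lborel {-1<..<1} (\<lambda>x. v x - d * u x)"
    using intu intv by (intro set_integral_diff) auto
  obtain C where C: "\<And>x. x \<in> {-1<..<1} \<Longrightarrow> \<bar>H 0 x\<bar> \<le> C * (1 - x) powr c"
    using endpoint_smooth_bound[OF H, of 0] by auto
  obtain B where B: "\<forall>x\<in>{-1..1}. \<bar>jacobi_poly (a + 1) (b + 1) n x\<bar> \<le> B"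
    using compact_imp_bounded
        [OF compact_continuous_image[OF continuous_on_jacobi_poly[of "{-1..1}" "a + 1" "b + 1" n] compact_Icc]]
    by (auto simp: bounded_iff)
  \<comment> \<open>The exponents a + c + 1 and b + 1 are positive, so \<open>E\<close> is
    continuous on the closed interval and zero at its ends. This removes the boundary terms even if
    \<open>H 0\<close> is unbounded at 1.\<close>
  define E where "E x = C * B * ((1 - x) powr (a + c + 1) * (1 + x) powr (b + 1))" for x
  have QE: "norm (Q x * H 0 x) \<le> E x" if x: "x \<in> {-1<..<1}" for x
  proof -
    have "norm (Q x * H 0 x) = jacobi_weight (a + 1) (b + 1) x * \<bar>H 0 x\<bar> * \<bar>jacobi_poly (a + 1) (b + 1) n x\<bar>"
      by (simp add: Q_def abs_mult jacobi_weight_nonneg)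
    also have "\<dots> \<le> jacobi_weight (a + 1) (b + 1) x * (C * (1 - x) powr c) * B"
      using C[OF x] B x
      by (intro mult_mono mult_nonneg_nonneg jacobi_weight_nonneg order.trans[OF abs_ge_zero C[OF x]]) auto
    also have "\<dots> = E x"
      by (simp add: E_def jacobi_weight_def powr_add)
    finally show ?thesis .
  qed
  have cE: "continuous_on {-1..1} E"
    unfolding E_def using a b by (intro continuous_intros continuous_on_powr') auto
  have E1: "(E \<longlongrightarrow> 0) (at_left 1)" and E2: "(E \<longlongrightarrow> 0) (at_right (-1))"
    using continuous_on_Icc_at_leftD[OF cE] continuous_on_Icc_at_rightD[OF cE]
    by (auto simp: E_def)
  have lim: "((\<lambda>x. Q x * H 0 x) \<longlongrightarrow> 0) (at_left 1)" "((\<lambda>x. Q x * H 0 x) \<longlongrightarrow> 0) (at_right (-1))"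
  proof -
    have ev: "eventually (\<lambda>x. x \<in> {-1<..<1::real}) (at_left 1)"
      by (rule eventually_at_leftI[of "-1"]) auto
    show "((\<lambda>x. Q x * H 0 x) \<longlongrightarrow> 0) (at_left 1)"
      by (rule Lim_null_comparison[OF eventually_mono[OF ev QE] E1])
    have ev: "eventually (\<lambda>x. x \<in> {-1<..<1::real}) (at_right (-1))"
      by (rule eventually_at_rightI[of _ 1]) auto
    show "((\<lambda>x. Q x * H 0 x) \<longlongrightarrow> 0) (at_right (-1))"
      by (rule Lim_null_comparison[OF eventually_mono[OF ev QE] E2])
  qed
  have deriv: "((\<lambda>x. Q x * H 0 x) has_real_derivative v x - d * u x) (at x)" if x: "x \<in> {-1<..<1}" for x
    using DERIV_mult[OF jacobi_poly_shift_deriv[OF x, of a b n] endpoint_smooth_deriv[OF H x, of 0]]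
    by (simp add: Q_def u_def v_def d_def algebra_simps)
  have cont: "isCont (\<lambda>x. v x - d * u x) x" if x: "x \<in> {-1<..<1}" for x
  proof -
    have "continuous_on {-1<..<1} (\<lambda>x. v x - d * u x)"
      unfolding v_def u_def jacobi_weight_def
      by (intro continuous_intros continuous_on_jacobi_poly endpoint_smooth_continuous[OF H]) auto
    then show ?thesis using x by (simp add: continuous_on_eq_continuous_at)
  qed
  have "(LBINT x=ereal (-1)..ereal 1. v x - d * u x) = 0 - 0"
  proof (rule interval_integral_FTC_integrable)
    show "((\<lambda>x. Q x * H 0 x) has_vector_derivative v x - d * u x) (at x)"
      if "ereal (-1) < ereal x" "ereal x < ereal 1" for x
      using deriv[of x] that
      by (auto simp: has_real_derivative_iff_has_vector_derivative)
    show "isCont (\<lambda>x. v x - d * u x) x"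
      if "ereal (-1) < ereal x" "ereal x < ereal 1" for x
      using cont[of x] that by auto
    show "set_integrable lborel (einterval (ereal (-1)) (ereal 1)) (\<lambda>x. v x - d * u x)"
      unfolding einterval_eq by (rule int)
    show "(((\<lambda>x. Q x * H 0 x) \<circ> real_of_ereal) \<longlongrightarrow> 0) (at_right (ereal (-1)))"
         "(((\<lambda>x. Q x * H 0 x) \<circ> real_of_ereal) \<longlongrightarrow> 0) (at_left (ereal 1))"
      using lim by (simp_all only: ereal_tendsto_simps)
  qed auto
  then have "(LBINT x:{-1<..<1}. v x - d * u x) = 0"
    by (simp only: interval_lebesgue_integral_def einterval_eq) simp
  then have "(LBINT x:{-1<..<1}. v x) - d * (LBINT x:{-1<..<1}. u x) = 0"
    using intu intv by (subst (asm) set_integral_diff) auto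
  moreover have "d > 0" by (simp add: d_def)
  ultimately have "(LBINT x:{-1<..<1}. u x) = 1 / d * (LBINT x:{-1<..<1}. v x)"
    by (simp add: field_simps)
  then show ?thesis unfolding u_def v_def d_def .
qed

text \<open>A step replaces (a, b, c) by (a + 1, b + 1, c - 1), which preserves a + c and hence the
  hypothesis. The constants of the single steps multiply up to the quotient of factorials.\<close>

lemma jacobi_by_parts_iterated:
  assumes "a + c > -1" "b > -1" "endpoint_smooth c H"
  shows "(LBINT x:{-1<..<1}. jacobi_weight a b x * H 0 x * jacobi_poly a b (m + n) x) =
     fact n / (2 ^ m * fact (m + n)) *
     (LBINT x:{-1<..<1}. jacobi_weight (a + real m) (b + real m) x * H m x *
        jacobi_poly (a + real m) (b + real m) n x)"
  using assms
proof (induction m arbitrary: a b c H)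
  case 0
  then show ?case by simp
next
  case (Suc m)
  have "(LBINT x:{-1<..<1}. jacobi_weight a b x * H 0 x * jacobi_poly a b (Suc m + n) x) =
     1 / (2 * real (Suc (m + n))) *
     (LBINT x:{-1<..<1}. jacobi_weight (a + 1) (b + 1) x * H 1 x * jacobi_poly (a + 1) (b + 1) (m + n) x)"
    using jacobi_by_parts[OF Suc.prems, of "m + n"] by simp
  also have "(LBINT x:{-1<..<1}. jacobi_weight (a + 1) (b + 1) x * H 1 x * jacobi_poly (a + 1) (b + 1) (m + n) x)
     = fact n / (2 ^ m * fact (m + n)) *
     (LBINT x:{-1<..<1}. jacobi_weight (a + 1 + real m) (b + 1 + real m) x * H (Suc m) x *
        jacobi_poly (a + 1 + real m) (b + 1 + real m) n x)"
    using Suc.IH[OF _ _ endpoint_smooth_Suc[OF Suc.prems(3)], of "a + 1" "b + 1"] Suc.prems by simp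
  finally show ?case
    by (simp add: add_ac field_simps)
qed

section \<open>Gamma asymptotics and the norm of the Jacobi polynomials\<close>

lemma set_integral_Icc_eq_Ioo:
  fixes f :: "real \<Rightarrow> real"
  shows "(LBINT x:{a..b}. f x) = (LBINT x:{a<..<b}. f x)"
  by (rule set_integral_discrete_difference[where X = "{a, b}"]) auto

lemma pos_not_nonpos_Int:
  fixes x :: real
  assumes "x > 0"
  shows "x \<notin> \<int>\<^sub>\<le>\<^sub>0"
proof
  assume "x \<in> \<int>\<^sub>\<le>\<^sub>0"
  then show False using assms by (elim nonpos_Ints_cases) simp
qed

text \<open>For a > 0 this is Euler's limit formula for Gamma; one use of the functional equation
  then reaches a > -1. That range covers the parameter a + b + 1 in
  \<open>jacobi_sigma_asymp\<close>, which may be negative.\<close>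

lemma Gamma_add_nat_asymp:
  fixes a :: real
  assumes "a > -1"
  shows "(\<lambda>n. Gamma (a + real n) / (fact n * real n powr (a - 1))) \<longlonglongrightarrow> 1"
proof -
  have *: "(\<lambda>n. Gamma (a + real n) / (fact n * real n powr (a - 1))) \<longlonglongrightarrow> 1" if a: "a > 0" for a :: real
  proof -
    have nz: "Gamma a \<noteq> 0" using a by (simp add: Gamma_eq_zero_iff pos_not_nonpos_Int)
    have "(\<lambda>n. Gamma a / Gamma_series' a n) \<longlonglongrightarrow> Gamma a / Gamma a"
      using nz by (intro tendsto_intros Gamma_series'_LIMSEQ) auto
    moreover have "eventually (\<lambda>n. Gamma a / Gamma_series' a n =
       Gamma (a + real n) / (fact n * real n powr (a - 1))) at_top"
      using eventually_gt_at_top[of 0]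
    proof eventually_elim
      case (elim n)
      have "pochhammer a n = Gamma (a + real n) / Gamma a"
        using a by (intro pochhammer_Gamma pos_not_nonpos_Int)
      moreover have "fact n = real n * fact (n - 1)"
        using elim by (simp add: fact_reduce)
      moreover have "real n powr (a - 1) = exp (a * ln (real n)) / real n"
        using elim by (simp add: powr_def exp_diff left_diff_distrib)
      ultimately show ?case
        using elim nz by (simp add: Gamma_series'_def)
    qed
    ultimately show ?thesis
      using nz by (auto dest: Lim_transform_eventually)
  qed
  have "(\<lambda>n. Gamma (a + 1 + real n) / (fact n * real n powr (a + 1 - 1)) * (real n / (a + real n))) \<longlonglongrightarrow> 1 * 1"
  proof (intro tendsto_mult *)
    show "(\<lambda>n. real n / (a + real n)) \<longlonglongrightarrow> 1" by real_asymp
  qed (use assms in auto)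
  moreover have "eventually (\<lambda>n. Gamma (a + 1 + real n) / (fact n * real n powr (a + 1 - 1)) * (real n / (a + real n))
      = Gamma (a + real n) / (fact n * real n powr (a - 1))) at_top"
    using eventually_gt_at_top[of 1]
  proof eventually_elim
    case (elim n)
    have pos: "a + real n > 0" using elim assms by linarith
    then have "Gamma (a + 1 + real n) = (a + real n) * Gamma (a + real n)"
      using Gamma_plus1[of "a + real n"] by (auto simp: add_ac pos_not_nonpos_Int)
    then show ?case
      using elim pos by (simp add: powr_diff)
  qed
  ultimately show ?thesis
    by (auto dest: Lim_transform_eventually)
qed

lemma Gamma_ratio_asymp:
  fixes a b :: real
  assumes "a > -1" "b > -1"
  shows "(\<lambda>n. Gamma (a + real n) / Gamma (b + real n) * real n powr (b - a)) \<longlonglongrightarrow> 1"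
proof -
  have "(\<lambda>n. Gamma (a + real n) / (fact n * real n powr (a - 1)) /
     (Gamma (b + real n) / (fact n * real n powr (b - 1)))) \<longlonglongrightarrow> 1 / 1"
    using assms by (intro tendsto_divide Gamma_add_nat_asymp) auto
  moreover have "eventually (\<lambda>n. Gamma (a + real n) / (fact n * real n powr (a - 1)) /
     (Gamma (b + real n) / (fact n * real n powr (b - 1))) =
     Gamma (a + real n) / Gamma (b + real n) * real n powr (b - a)) at_top"
    using eventually_gt_at_top[of 0]
    by eventually_elim (simp add: powr_diff field_simps)
  ultimately show ?thesis
    by (auto dest: Lim_transform_eventually)
qed

text \<open>The Beta value contains the quotient Gamma(b + 1 + n) / Gamma(c + b + 2 + n), of order
  n^(-c-1); the factor 2^n is due to the length 2 of the interval. Only the exponent at -1 grows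
  with n, which is the situation after n integrations by parts against a power of 1 - x.\<close>

lemma jacobi_weight_integral_bound:
  assumes "c > -1" "b > -1"
  obtains C where "\<And>n. n \<ge> 1 \<Longrightarrow>
    (LBINT x:{-1<..<1}. jacobi_weight c (b + real n) x) \<le> C * 2 ^ n * real n powr (- c - 1)"
proof -
  define r where "r n = Gamma (b + 1 + real n) / Gamma (c + b + 2 + real n) * real n powr (c + b + 2 - (b + 1))" for n
  have "r \<longlonglongrightarrow> 1"
    unfolding r_def using assms by (intro Gamma_ratio_asymp) auto
  then obtain K where K: "\<And>n. norm (r n) \<le> K"
    by (meson Bseq_def convergentI convergent_imp_Bseq)
  have "(LBINT x:{-1<..<1}. jacobi_weight c (b + real n) x) \<le>
      2 powr (c + b + 1) * Gamma (c + 1) * K * 2 ^ n * real n powr (- c - 1)" if n: "n \<ge> 1" for n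
  proof -
    have "(LBINT x:{-1<..<1}. jacobi_weight c (b + real n) x)
       = 2 powr (c + (b + real n) + 1) * Beta (c + 1) (b + real n + 1)"
      using assms by (intro jacobi_weight_integral_eq) auto
    also have "2 powr (c + (b + real n) + 1) = 2 powr (c + b + 1) * 2 ^ n"
      by (simp add: powr_add powr_realpow)
    also have "Beta (c + 1) (b + real n + 1) = Gamma (c + 1) * r n * real n powr (- c - 1)"
    proof -
      have "real n powr (c + b + 2 - (b + 1)) * real n powr (- c - 1) = 1"
        using n by (simp flip: powr_add)
      then have "r n * real n powr (- c - 1) = Gamma (b + 1 + real n) / Gamma (c + b + 2 + real n)"
        unfolding r_def by (simp only: mult.assoc mult_1_right)
      then show ?thesis
        by (simp add: Beta_def add_ac mult.assoc)
    qed
    also have "2 powr (c + b + 1) * 2 ^ n * (Gamma (c + 1) * r n * real n powr (- c - 1)) \<le>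
       2 powr (c + b + 1) * 2 ^ n * (Gamma (c + 1) * K * real n powr (- c - 1))"
      using assms K[of n] Gamma_real_pos[of "c + 1"]
      by (intro mult_left_mono mult_right_mono) auto
    finally show ?thesis
      by (simp add: mult_ac)
  qed
  then show ?thesis using that by blast
qed

section \<open>The squared norm of the Jacobi polynomials\<close>

text \<open>On the interval (1 - x)^(-k) is at least 2^(-k), so boundedness of all derivatives gives
  growth exponent 0.\<close>

lemma endpoint_smooth_bounded:
  assumes "\<And>k x. x \<in> {-1<..<1} \<Longrightarrow> (H k has_real_derivative H (Suc k) x) (at x)"
    and "\<And>k. \<exists>B. \<forall>x\<in>{-1<..<1}. \<bar>H k x\<bar> \<le> B"
  shows "endpoint_smooth 0 H"
  unfolding endpoint_smooth_def
proof (intro allI conjI)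
  fix k
  obtain B where B: "\<And>x. x \<in> {-1<..<1} \<Longrightarrow> \<bar>H k x\<bar> \<le> B" using assms(2) by blast
  have "\<bar>H k x\<bar> \<le> B * 2 powr (real k) * (1 - x) powr (0 - real k)" if x: "x \<in> {-1<..<1}" for x
  proof -
    have "(1::real) = 2 powr (real k) * 2 powr (- real k)"
      by (simp flip: powr_add)
    also have "\<dots> \<le> 2 powr (real k) * (1 - x) powr (0 - real k)"
      using x by (intro mult_left_mono) (auto intro!: powr_mono2')
    finally have "B * 1 \<le> B * (2 powr (real k) * (1 - x) powr (0 - real k))"
      using order.trans[OF abs_ge_zero B[OF x]] by (rule mult_left_mono)
    then show ?thesis using B[OF x] by (simp add: mult_ac)
  qed
  then show "\<exists>C. \<forall>x\<in>{-1<..<1}. \<bar>H k x\<bar> \<le> C * (1 - x) powr (0 - real k)" by blast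
qed (use assms in blast)

text \<open>Each summand is a product of n linear factors with leading coefficient 1/2, so the
  coefficient of x^n is 2^(-n) times a Vandermonde convolution.\<close>

lemma jacobi_poly_eq_poly:
  obtains p where "\<And>x. poly p x = jacobi_poly a b n x" "degree p \<le> n"
    "coeff p n = ((2 * real n + a + b) gchoose n) / 2 ^ n"
proof -
  define u where "u = [:-1/2, 1/2::real:]"
  define v where "v = [:1/2, 1/2::real:]"
  define q where "q s = u ^ s * v ^ (n - s)" for s
  define p where "p = (\<Sum>s\<le>n. smult (((real n + a) gchoose (n - s)) * ((real n + b) gchoose s)) (q s))"
  have [simp]: "u \<noteq> 0" "v \<noteq> 0" "degree u = 1" "degree v = 1" "lead_coeff u = 1/2" "lead_coeff v = 1/2"
    by (auto simp: u_def v_def)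
  have degq: "degree (q s) = n" if "s \<le> n" for s
    using that by (simp add: q_def degree_mult_eq degree_power_eq)
  have coeffq: "coeff (q s) n = 1 / 2 ^ n" if "s \<le> n" for s
  proof -
    have "coeff (q s) n = lead_coeff (q s)" using degq[OF that] by simp
    also have "\<dots> = (1/2) ^ s * (1/2) ^ (n - s)"
      unfolding q_def lead_coeff_mult lead_coeff_power by (simp add: u_def v_def)
    also have "\<dots> = 1 / 2 ^ n"
      using that by (simp add: power_divide flip: power_add)
    finally show ?thesis .
  qed
  have "poly p x = jacobi_poly a b n x" for x
    unfolding p_def jacobi_poly_def poly_sum
    by (intro sum.cong) (auto simp: q_def u_def v_def field_simps diff_divide_distrib[symmetric] add_divide_distrib[symmetric])
  moreover have "degree p \<le> n"
    unfolding p_def using degq by (intro degree_sum_le) (auto intro: order.trans[OF degree_smult_le])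
  moreover have "coeff p n = ((2 * real n + a + b) gchoose n) / 2 ^ n"
  proof -
    have "coeff p n = (\<Sum>s\<in>{0..n}. ((real n + b) gchoose s) * ((real n + a) gchoose (n - s))) / 2 ^ n"
      unfolding p_def coeff_sum sum_divide_distrib
      by (intro sum.cong) (auto simp: coeffq)
    also have "\<dots> = ((real n + b + (real n + a)) gchoose n) / 2 ^ n"
      by (simp only: gbinomial_Vandermonde)
    finally show ?thesis by (simp add: algebra_simps)
  qed
  ultimately show ?thesis using that by blast
qed

text \<open>One factor of the squared polynomial is taken as \<open>H 0\<close> and integrated by
  parts n times. Its n-th derivative is n! times the leading coefficient, the other factor drops to
  degree 0, and a weight integral is left.\<close>

lemma jacobi_sigma_eq:
  assumes a: "a > -1" and b: "b > -1"
  shows "jacobi_sigma a b n = ((2 * real n + a + b) gchoose n) * 2 powr (a + b + 1) * Beta (a + real n + 1) (b + real n + 1)"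
proof -
  obtain p where p: "\<And>x. poly p x = jacobi_poly a b n x" "degree p \<le> n"
    "coeff p n = ((2 * real n + a + b) gchoose n) / 2 ^ n"
    using jacobi_poly_eq_poly by blast
  define H where "H k = poly ((pderiv ^^ k) p)" for k
  have H: "endpoint_smooth 0 H"
  proof (rule endpoint_smooth_bounded)
    show "(H k has_real_derivative H (Suc k) x) (at x)" for k x
      unfolding H_def by (simp add: poly_DERIV)
    show "\<exists>B. \<forall>x\<in>{-1<..<1}. \<bar>H k x\<bar> \<le> B" for k
    proof -
      have "continuous_on {-1..1} (H k)"
        unfolding H_def by (intro continuous_intros)
      from compact_imp_bounded[OF compact_continuous_image[OF this compact_Icc]]
      obtain B where "\<forall>y\<in>H k ` {-1..1}. norm y \<le> B" by (auto simp: bounded_iff)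
      then show ?thesis by (intro exI[of _ B]) auto
    qed
  qed
  have "(pderiv ^^ n) p = [:fact n * coeff p n:]"
  proof (rule poly_eqI)
    fix i show "coeff ((pderiv ^^ n) p) i = coeff [:fact n * coeff p n:] i"
    proof (cases i)
      case 0
      then show ?thesis by (simp add: coeff_higher_pderiv pochhammer_fact)
    next
      case (Suc j)
      then have "coeff p (i + n) = 0" using p(2) by (intro coeff_eq_0) auto
      then show ?thesis using Suc by (simp add: coeff_higher_pderiv add.commute)
    qed
  qed
  then have Hn: "H n x = fact n * coeff p n" for x
    by (simp add: H_def)
  have "jacobi_sigma a b n = (LBINT x:{-1<..<1}. jacobi_weight a b x * H 0 x * jacobi_poly a b (n + 0) x)"
    by (simp add: jacobi_sigma_def set_integral_Icc_eq_Ioo H_def p(1) power2_eq_square mult.assoc)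
  also have "\<dots> = fact 0 / (2 ^ n * fact (n + 0)) *
     (LBINT x:{-1<..<1}. jacobi_weight (a + real n) (b + real n) x * H n x *
        jacobi_poly (a + real n) (b + real n) 0 x)"
    using a b H by (intro jacobi_by_parts_iterated) auto
  also have "\<dots> = 1 / 2 ^ n * coeff p n * (LBINT x:{-1<..<1}. jacobi_weight (a + real n) (b + real n) x)"
    by (simp add: Hn jacobi_poly_def mult.assoc)
  also have "\<dots> = 1 / 2 ^ n * coeff p n * (2 powr (a + real n + (b + real n) + 1) * Beta (a + real n + 1) (b + real n + 1))"
    using a b by (subst jacobi_weight_integral_eq) auto
  also have "2 powr (a + real n + (b + real n) + 1) = 2 powr (a + b + 1) * 2 ^ n * 2 ^ n"
  proof -
    have "a + real n + (b + real n) + 1 = (a + b + 1) + real n + real n" by simp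
    then show ?thesis by (simp only: powr_add) (simp add: powr_realpow)
  qed
  finally show ?thesis
    by (simp add: p(3))
qed

text \<open>With the binomial written as a Gamma quotient, Gamma(2n + a + b + 1) cancels against the
  denominator of the Beta value up to the factor 2n + a + b + 1. Two Gamma quotients of orders n^a
  and n^(-a) remain.\<close>

lemma jacobi_sigma_asymp:
  assumes a: "a > -1" and b: "b > -1"
  shows "(\<lambda>n. real n * jacobi_sigma a b n) \<longlonglongrightarrow> 2 powr (a + b)"
proof -
  have "(\<lambda>n. 2 powr (a + b) * (Gamma (a + 1 + real n) / Gamma (1 + real n) * real n powr (1 - (a + 1))) *
    (Gamma (b + 1 + real n) / Gamma (a + b + 1 + real n) * real n powr (a + b + 1 - (b + 1))) *
    (2 * real n / (2 * real n + a + b + 1))) \<longlonglongrightarrow> 2 powr (a + b) * 1 * 1 * 1"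
  proof (intro tendsto_mult tendsto_const Gamma_ratio_asymp)
    show "(\<lambda>n. 2 * real n / (2 * real n + a + b + 1)) \<longlonglongrightarrow> 1" by real_asymp
  qed (use a b in auto)
  moreover have "eventually (\<lambda>n. 2 powr (a + b) * (Gamma (a + 1 + real n) / Gamma (1 + real n) * real n powr (1 - (a + 1))) *
    (Gamma (b + 1 + real n) / Gamma (a + b + 1 + real n) * real n powr (a + b + 1 - (b + 1))) *
    (2 * real n / (2 * real n + a + b + 1)) = real n * jacobi_sigma a b n) at_top"
    using eventually_gt_at_top[of 0]
  proof eventually_elim
    case (elim n)
    have pos: "a + b + 1 + real n > 0" "2 * real n + a + b + 1 > 0"
      using a b elim by linarith+
    have "((2 * real n + a + b) gchoose n) = pochhammer (a + b + 1 + real n) n / fact n"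
      by (simp add: gbinomial_pochhammer' algebra_simps)
    also have "pochhammer (a + b + 1 + real n) n = Gamma (2 * real n + a + b + 1) / Gamma (a + b + 1 + real n)"
      using pos by (subst pochhammer_Gamma) (auto simp: add_ac pos_not_nonpos_Int)
    finally have 1: "((2 * real n + a + b) gchoose n) =
       Gamma (2 * real n + a + b + 1) / Gamma (a + b + 1 + real n) / Gamma (1 + real n)"
      by (simp add: Gamma_fact)
    have 2: "Beta (a + real n + 1) (b + real n + 1) = Gamma (a + 1 + real n) * Gamma (b + 1 + real n) /
       ((2 * real n + a + b + 1) * Gamma (2 * real n + a + b + 1))"
    proof -
      have "2 * real n + a + b + 1 \<notin> \<int>\<^sub>\<le>\<^sub>0" using pos by (intro pos_not_nonpos_Int)
      from Gamma_plus1[OF this] have "Gamma (a + real n + 1 + (b + real n + 1)) =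
          (2 * real n + a + b + 1) * Gamma (2 * real n + a + b + 1)"
        by (simp add: algebra_simps)
      then show ?thesis by (simp add: Beta_def add_ac)
    qed
    have 3: "real n powr (1 - (a + 1)) * real n powr (a + b + 1 - (b + 1)) = 1"
      using elim by (simp flip: powr_add)
    have 4: "Gamma (2 * real n + a + b + 1) > 0" "Gamma (a + b + 1 + real n) > 0" "Gamma (1 + real n) > 0"
      using pos by (auto intro!: Gamma_real_pos)
    have gen: "m * (X / Y / Z * (2 * t) * (A * B / (D * X))) = t * (A / Z) * (B / Y) * (2 * m / D) * 1"
      if "X > 0" "Y > 0" "Z > 0" "D > 0" for X Y Z D m t A B :: real
      using that by (simp add: field_simps)
    have "2 powr (a + b + 1) = 2 * 2 powr (a + b)" by (simp add: powr_add)
    then have sigma: "real n * jacobi_sigma a b n = 2 powr (a + b) * (Gamma (a + 1 + real n) / Gamma (1 + real n)) *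
      (Gamma (b + 1 + real n) / Gamma (a + b + 1 + real n)) * (2 * real n / (2 * real n + a + b + 1)) * 1"
      unfolding jacobi_sigma_eq[OF a b] 1 2 using gen[OF 4 pos(2)] by simp
    have gen': "t * (A * p) * (B * q) * F = t * A * B * F * 1" if "p * q = 1" for t A B F p q :: real
      using that by (metis mult.assoc mult.commute)
    show ?case by (rule trans[OF gen'[OF 3] sigma[symmetric]])
  qed
  ultimately show ?thesis
    by (auto dest: Lim_transform_eventually)
qed

section \<open>Moments of powers with logarithms\<close>

text \<open>For y = \<epsilon> (1 + |ln s|) the exponential series gives y^m / m! <= exp y, and
  exp(\<epsilon> |ln s|) is one of the two powers of s. Both signs occur because the later argument
  s = n (1 - x) lies on either side of 1.\<close>

lemma one_plus_abs_ln_powr_bound: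
  fixes \<epsilon> :: real
  assumes "\<epsilon> > 0"
  obtains C where "C > 0" "\<And>s. s > 0 \<Longrightarrow> (1 + \<bar>ln s\<bar>) ^ m \<le> C * (s powr \<epsilon> + s powr (- \<epsilon>))"
proof -
  define C where "C = exp \<epsilon> * fact m / \<epsilon> ^ m"
  have "C > 0" using assms by (simp add: C_def)
  moreover have "(1 + \<bar>ln s\<bar>) ^ m \<le> C * (s powr \<epsilon> + s powr (- \<epsilon>))" if s: "s > 0" for s
  proof -
    define y where "y = \<epsilon> * (1 + \<bar>ln s\<bar>)"
    have "y ^ m / fact m \<le> exp y"
    proof -
      have "y \<ge> 0" using assms by (simp add: y_def)
      then have "(\<Sum>i\<in>{m}. y ^ i /\<^sub>R fact i) \<le> (\<Sum>i. y ^ i /\<^sub>R fact i)"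
        by (intro sum_le_suminf summable_exp_generic) auto
      then show ?thesis by (simp add: exp_def divide_inverse mult.commute)
    qed
    also have "exp y = exp \<epsilon> * exp (\<epsilon> * \<bar>ln s\<bar>)"
      by (simp add: y_def algebra_simps flip: exp_add)
    also have "exp (\<epsilon> * \<bar>ln s\<bar>) \<le> s powr \<epsilon> + s powr (- \<epsilon>)"
      using s by (auto simp: powr_def abs_if)
    finally have "y ^ m / fact m \<le> exp \<epsilon> * (s powr \<epsilon> + s powr (- \<epsilon>))" by simp
    moreover have "y ^ m = \<epsilon> ^ m * (1 + \<bar>ln s\<bar>) ^ m"
      by (simp only: y_def power_mult_distrib)
    ultimately show ?thesis
      using assms by (simp add: C_def field_simps)
  qed
  ultimately show ?thesis using that by blast
qed

section \<open>Products of the factors |k - \<gamma>| + M / ln n\<close>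

lemma harm_le_ln: "n \<ge> 1 \<Longrightarrow> harm n \<le> ln (real n) + 1"
proof (induction n rule: dec_induct)
  case base
  then show ?case by (simp add: harm_expand)
next
  case (step n)
  have n: "real n > 0" using step by simp
  have "ln (real n / real (Suc n)) \<le> real n / real (Suc n) - 1"
    using n by (intro ln_le_minus_one) auto
  also have "\<dots> = - inverse (real (Suc n))"
    by (simp add: field_simps)
  also have "ln (real n / real (Suc n)) = ln (real n) - ln (real (Suc n))"
    using n by (intro ln_divide_pos) auto
  finally show ?case
    using step.IH by (simp add: harm_Suc)
qed

text \<open>From k0 on, k - \<gamma> is positive, and with \<delta> = M / ln n each factor is (k+1)
  (1 - (\<gamma>+1-\<delta>)/(k+1)), at most (k+1) exp(-(\<gamma>+1-\<delta>)/(k+1)). The product is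
  thus at most n! exp(-(\<gamma>+1-\<delta>) S), where the harmonic segment S is ln n + O(1). The
  perturbation costs only a constant because \<delta> ln n = M.\<close>

lemma prod_abs_diff_tail_bound:
  fixes \<gamma> M :: real
  assumes \<gamma>: "\<bar>\<gamma>\<bar> < real k0" and M: "M \<ge> 0"
  obtains C where "C > 0"
    "\<And>n. n \<ge> 3 \<Longrightarrow> n \<ge> k0 \<Longrightarrow>
       (\<Prod>k\<in>{k0..<n}. \<bar>real k - \<gamma>\<bar> + M / ln (real n)) \<le> C * fact n * real n powr (- \<gamma> - 1)"
proof -
  \<comment> \<open>The first factor pays for \<delta> S, as \<delta> (ln n + 1) <= 2 M; the second
    pays for replacing S by ln n, since these differ by at most \<open>harm k0 + 1\<close>.\<close>
  define C where "C = exp (2 * M) * exp (\<bar>\<gamma> + 1\<bar> * (harm k0 + 1))"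
  have "C > 0" by (simp add: C_def)
  moreover have "(\<Prod>k\<in>{k0..<n}. \<bar>real k - \<gamma>\<bar> + M / ln (real n)) \<le> C * fact n * real n powr (- \<gamma> - 1)"
    if n: "n \<ge> 3" "n \<ge> k0" for n
  proof -
    define R where "R = ln (real n)"
    have R: "R \<ge> 1" unfolding R_def
      using n exp_le by (subst ln_ge_iff) (auto intro: order.trans)
    define \<delta> where "\<delta> = M / R"
    have \<delta>: "\<delta> \<ge> 0" "\<delta> \<le> M" "\<delta> * R = M"
      using M R by (auto simp: \<delta>_def field_simps mult_le_cancel_left1)
    define S where "S = (\<Sum>k\<in>{k0..<n}. inverse (real (Suc k)))"
    have S: "S = harm n - harm k0"
    proof -
      have "harm n = (\<Sum>k<n. inverse (real (Suc k)))" "harm k0 = (\<Sum>k<k0. inverse (real (Suc k)))"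
        by (simp_all add: harm_altdef)
      then show ?thesis
        using sum.atLeastLessThan_concat[of 0 k0 n "\<lambda>k. inverse (real (Suc k))"] n
        by (simp add: S_def lessThan_atLeast0)
    qed
    have "R \<le> ln (real n + 1)"
      unfolding R_def using n by (subst ln_le_cancel_iff) auto
    then have "harm n \<ge> R" using ln_le_harm[of n] by linarith
    moreover have "harm n \<le> R + 1" using harm_le_ln[of n] n by (simp add: R_def)
    ultimately have S1: "\<bar>S - R\<bar> \<le> harm k0 + 1" and S2: "S \<le> R + 1"
      using harm_nonneg[of k0, where 'a = real] by (auto simp: S)
    have "(\<Prod>k\<in>{k0..<n}. \<bar>real k - \<gamma>\<bar> + \<delta>) \<le>
       (\<Prod>k\<in>{k0..<n}. real (Suc k) * exp (- (\<gamma> + 1 - \<delta>) * inverse (real (Suc k))))"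
    proof (intro prod_mono conjI)
      fix k assume k: "k \<in> {k0..<n}"
      show "0 \<le> \<bar>real k - \<gamma>\<bar> + \<delta>" using \<delta> by simp
      have "\<bar>real k - \<gamma>\<bar> + \<delta> = real (Suc k) * (1 + (- (\<gamma> + 1 - \<delta>) * inverse (real (Suc k))))"
        using k \<gamma> by (auto simp: field_simps abs_if)
      also have "\<dots> \<le> real (Suc k) * exp (- (\<gamma> + 1 - \<delta>) * inverse (real (Suc k)))"
        by (intro mult_left_mono exp_ge_add_one_self) auto
      finally show "\<bar>real k - \<gamma>\<bar> + \<delta> \<le> real (Suc k) * exp (- (\<gamma> + 1 - \<delta>) * inverse (real (Suc k)))" .
    qed
    also have "\<dots> = (\<Prod>k\<in>{k0..<n}. real (Suc k)) * exp (- (\<gamma> + 1 - \<delta>) * S)"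
      by (simp add: prod.distrib S_def sum_distrib_left flip: exp_sum)
    also have "\<dots> \<le> fact n * (C * real n powr (- \<gamma> - 1))"
    proof (intro mult_mono)
      have "(\<Prod>k\<in>{k0..<n}. real (Suc k)) \<le> (\<Prod>k\<in>{0..<n}. real (Suc k))"
        by (intro prod_mono2) auto
      also have "\<dots> = fact n"
        by (simp add: fact_prod_Suc)
      finally show "(\<Prod>k\<in>{k0..<n}. real (Suc k)) \<le> fact n" .
      have "- (\<gamma> + 1) * (S - R) \<le> \<bar>\<gamma> + 1\<bar> * \<bar>S - R\<bar>"
        by (metis abs_ge_minus_self abs_mult mult_minus_left)
      also have "\<dots> \<le> \<bar>\<gamma> + 1\<bar> * (harm k0 + 1)"
        using S1 by (intro mult_left_mono) auto
      finally have "- (\<gamma> + 1) * (S - R) \<le> \<bar>\<gamma> + 1\<bar> * (harm k0 + 1)" .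
      moreover have "\<delta> * S \<le> \<delta> * (R + 1)" using S2 \<delta> by (intro mult_left_mono) auto
      moreover have "\<delta> * (R + 1) \<le> 2 * M" using \<delta> by (simp add: algebra_simps)
      moreover have "- (\<gamma> + 1 - \<delta>) * S = (- \<gamma> - 1) * R + - (\<gamma> + 1) * (S - R) + \<delta> * S"
        by (simp add: algebra_simps)
      ultimately have "- (\<gamma> + 1 - \<delta>) * S \<le> 2 * M + \<bar>\<gamma> + 1\<bar> * (harm k0 + 1) + (- \<gamma> - 1) * R"
        by linarith
      then have "exp (- (\<gamma> + 1 - \<delta>) * S) \<le> exp (2 * M + \<bar>\<gamma> + 1\<bar> * (harm k0 + 1) + (- \<gamma> - 1) * R)"
        by simp
      also have "\<dots> = C * real n powr (- \<gamma> - 1)"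
        using n unfolding C_def exp_add powr_def R_def by auto
      finally show "exp (- (\<gamma> + 1 - \<delta>) * S) \<le> C * real n powr (- \<gamma> - 1)" .
    qed auto
    finally show ?thesis by (simp add: \<delta>_def R_def mult_ac)
  qed
  ultimately show ?thesis using that by blast
qed

text \<open>The finitely many factors below k0 are each at most the constant \<open>B\<close>. As k0
  exceeds |\<gamma>|, a natural number \<gamma> is among these k, and its factor is M / ln n
  alone.\<close>

lemma prod_abs_diff_bound:
  fixes \<gamma> M :: real
  assumes M: "M \<ge> 0"
  obtains C N where "C > 0" "N \<ge> 3" "\<And>n. n \<ge> N \<Longrightarrow>
       (\<Prod>k<n. \<bar>real k - \<gamma>\<bar> + M / ln (real n)) \<le>
       C * fact n * real n powr (- \<gamma> - 1) * (if \<gamma> \<in> \<nat> then 1 / ln (real n) else 1)"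
proof -
  define k0 where "k0 = nat \<lfloor>\<bar>\<gamma>\<bar>\<rfloor> + 1"
  have k0: "\<bar>\<gamma>\<bar> < real k0" unfolding k0_def by linarith
  define B where "B = real k0 + \<bar>\<gamma>\<bar> + M + 1"
  have B: "B \<ge> 1" "B \<ge> M" using M by (auto simp: B_def)
  obtain C where C: "C > 0" "\<And>n. n \<ge> 3 \<Longrightarrow> n \<ge> k0 \<Longrightarrow>
       (\<Prod>k\<in>{k0..<n}. \<bar>real k - \<gamma>\<bar> + M / ln (real n)) \<le> C * fact n * real n powr (- \<gamma> - 1)"
    using prod_abs_diff_tail_bound[OF k0 M] by blast
  have "(\<Prod>k<n. \<bar>real k - \<gamma>\<bar> + M / ln (real n)) \<le>
       B ^ k0 * C * fact n * real n powr (- \<gamma> - 1) * (if \<gamma> \<in> \<nat> then 1 / ln (real n) else 1)"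
    if n: "n \<ge> max 3 k0" for n
  proof -
    define R where "R = ln (real n)"
    have R: "R \<ge> 1" unfolding R_def
      using n exp_le by (subst ln_ge_iff) (auto intro: order.trans)
    define t where "t k = \<bar>real k - \<gamma>\<bar> + M / R" for k
    have t0: "t k \<ge> 0" for k using M R by (auto simp: t_def)
    have "M / R \<le> M" using M R by (simp add: field_simps mult_le_cancel_left1)
    then have tB: "t k \<le> B" if "k < k0" for k
      using that by (auto simp: t_def B_def)
    have head: "(\<Prod>k<k0. t k) \<le> B ^ k0 * (if \<gamma> \<in> \<nat> then 1 / R else 1)"
    proof (cases "\<gamma> \<in> \<nat>")
      case True
      then obtain m where m: "\<gamma> = real m" by (auto elim!: Nats_cases)
      have mk: "m < k0" using k0 m by simp
      have "(\<Prod>k<k0. t k) = t m * (\<Prod>k\<in>{..<k0} - {m}. t k)"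
        using mk by (intro prod.remove) auto
      also have "\<dots> \<le> (B / R) * (\<Prod>k\<in>{..<k0} - {m}. B)"
        using t0 tB B M R by (intro mult_mono prod_mono prod_nonneg) (auto simp: m t_def divide_right_mono)
      also have "\<dots> = B ^ k0 / R"
        using mk by (simp add: power_eq_if)
      finally show ?thesis using True by simp
    next
      case False
      have "(\<Prod>k<k0. t k) \<le> (\<Prod>k<k0. B)"
        using t0 tB by (intro prod_mono) auto
      then show ?thesis using False by simp
    qed
    have "(\<Prod>k<n. t k) = (\<Prod>k<k0. t k) * (\<Prod>k\<in>{k0..<n}. t k)"
      using prod.atLeastLessThan_concat[of 0 k0 n t] n by (simp add: lessThan_atLeast0)
    also have "\<dots> \<le> (B ^ k0 * (if \<gamma> \<in> \<nat> then 1 / R else 1)) * (C * fact n * real n powr (- \<gamma> - 1))"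
      using head C(2)[of n] n B R t0
      by (intro mult_mono prod_nonneg) (auto simp: t_def R_def)
    finally show ?thesis by (simp only: t_def R_def mult_ac)
  qed
  moreover have "B ^ k0 * C > 0" using B C by simp
  ultimately show ?thesis using that[of "B ^ k0 * C" "max 3 k0"] by auto
qed

text \<open>\<open>logq \<gamma> \<mu> k\<close> is the polynomial \<open>q\<close> with
  \<open>(d/dx)^k ((1-x)^\<gamma> ln(1-x)^\<mu>) = (1-x)^(\<gamma>-k) q(ln(1-x))\<close>.\<close>

fun logq :: "real \<Rightarrow> nat \<Rightarrow> nat \<Rightarrow> real poly" where
  "logq \<gamma> \<mu> 0 = monom 1 \<mu>"
| "logq \<gamma> \<mu> (Suc k) = smult (real k - \<gamma>) (logq \<gamma> \<mu> k) - pderiv (logq \<gamma> \<mu> k)"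

lemma degree_logq: "degree (logq \<gamma> \<mu> k) \<le> \<mu>"
proof (induction k)
  case (Suc k)
  then show ?case
    by (auto intro!: degree_diff_le order.trans[OF degree_smult_le] simp: degree_pderiv)
qed (simp add: degree_monom_le)

section \<open>The weighted coefficient norm\<close>

text \<open>The weight R^i reflects that the polynomials are evaluated at ln(1 - x), which has size
  about R = ln n where 1 - x is of order 1/n.\<close>

definition coeff_norm :: "nat \<Rightarrow> real \<Rightarrow> real poly \<Rightarrow> real" where
  "coeff_norm m R q = (\<Sum>i\<le>m. \<bar>coeff q i\<bar> * R ^ i)"

lemma coeff_norm_nonneg: "R \<ge> 0 \<Longrightarrow> coeff_norm m R q \<ge> 0"
  by (auto simp: coeff_norm_def intro!: sum_nonneg)

text \<open>Differentiation multiplies the coefficient of u^i by i <= m and lowers its weight from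
  R^i to R^(i-1), so in this norm its size is at most m / R.\<close>

lemma coeff_norm_smult_minus_pderiv:
  assumes R: "R > 0" and q: "degree q \<le> m"
  shows "coeff_norm m R (smult c q - pderiv q) \<le> (\<bar>c\<bar> + real m / R) * coeff_norm m R q"
proof -
  have "coeff_norm m R (smult c q - pderiv q) \<le>
     (\<Sum>i\<le>m. \<bar>c\<bar> * (\<bar>coeff q i\<bar> * R ^ i) + 1 / R * (real (Suc i) * (\<bar>coeff q (Suc i)\<bar> * R ^ Suc i)))"
    unfolding coeff_norm_def
  proof (rule sum_mono)
    fix i
    have "\<bar>coeff (smult c q - pderiv q) i\<bar> \<le> \<bar>c\<bar> * \<bar>coeff q i\<bar> + real (Suc i) * \<bar>coeff q (Suc i)\<bar>"
      using abs_triangle_ineq4[of "c * coeff q i" "real (Suc i) * coeff q (Suc i)"]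
      by (simp add: coeff_pderiv abs_mult)
    then have "\<bar>coeff (smult c q - pderiv q) i\<bar> * R ^ i \<le> (\<bar>c\<bar> * \<bar>coeff q i\<bar> + real (Suc i) * \<bar>coeff q (Suc i)\<bar>) * R ^ i"
      using R by (intro mult_right_mono) auto
    then show "\<bar>coeff (smult c q - pderiv q) i\<bar> * R ^ i \<le>
       \<bar>c\<bar> * (\<bar>coeff q i\<bar> * R ^ i) + 1 / R * (real (Suc i) * (\<bar>coeff q (Suc i)\<bar> * R ^ Suc i))"
      using R by (simp add: algebra_simps)
  qed
  also have "\<dots> = \<bar>c\<bar> * coeff_norm m R q + 1 / R * (\<Sum>i\<le>m. real (Suc i) * (\<bar>coeff q (Suc i)\<bar> * R ^ Suc i))"
    by (simp only: sum.distrib coeff_norm_def sum_distrib_left)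
  \<comment> \<open>The index shift adds a zero term at i = 0; the term at i = m + 1 then disappears
    by the degree bound.\<close>
  also have "(\<Sum>i\<le>m. real (Suc i) * (\<bar>coeff q (Suc i)\<bar> * R ^ Suc i)) = (\<Sum>i\<le>Suc m. real i * (\<bar>coeff q i\<bar> * R ^ i))"
    by (simp add: sum.atMost_Suc_shift del: sum.atMost_Suc)
  also have "\<dots> = (\<Sum>i\<le>m. real i * (\<bar>coeff q i\<bar> * R ^ i))"
    using q by (simp add: coeff_eq_0)
  also have "\<dots> \<le> (\<Sum>i\<le>m. real m * (\<bar>coeff q i\<bar> * R ^ i))"
    using R by (intro sum_mono mult_right_mono) auto
  also have "\<dots> = real m * coeff_norm m R q"
    by (simp add: coeff_norm_def sum_distrib_left)
  finally show ?thesis using R by (simp add: algebra_simps divide_right_mono mult_left_mono)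
qed

lemma coeff_norm_logq:
  assumes R: "R > 0"
  shows "coeff_norm \<mu> R (logq \<gamma> \<mu> n) \<le> R ^ \<mu> * (\<Prod>k<n. \<bar>real k - \<gamma>\<bar> + real \<mu> / R)"
proof (induction n)
  case 0
  have "coeff_norm \<mu> R (monom 1 \<mu>) = (\<Sum>i\<le>\<mu>. if i = \<mu> then R ^ i else 0)"
    unfolding coeff_norm_def by (intro sum.cong) auto
  then show ?case by simp
next
  case (Suc n)
  have "coeff_norm \<mu> R (logq \<gamma> \<mu> (Suc n)) \<le> (\<bar>real n - \<gamma>\<bar> + real \<mu> / R) * coeff_norm \<mu> R (logq \<gamma> \<mu> n)"
    using coeff_norm_smult_minus_pderiv[OF R degree_logq] by simp
  also have "\<dots> \<le> (\<bar>real n - \<gamma>\<bar> + real \<mu> / R) * (R ^ \<mu> * (\<Prod>k<n. \<bar>real k - \<gamma>\<bar> + real \<mu> / R))"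
    using R by (intro mult_left_mono Suc.IH) auto
  finally show ?case by (simp add: mult_ac)
qed

text \<open>Each |y|^i is R^i (|y|/R)^i. Adding 1 to the base makes its powers increase with the
  exponent, so the exponent m serves for all i.\<close>

lemma poly_le_coeff_norm:
  assumes R: "R > 0" and q: "degree q \<le> m"
  shows "\<bar>poly q y\<bar> \<le> coeff_norm m R q * (1 + \<bar>y\<bar> / R) ^ m"
proof -
  have "poly q y = (\<Sum>i\<le>m. coeff q i * y ^ i)"
    unfolding poly_altdef using q by (intro sum.mono_neutral_left) (auto simp: coeff_eq_0)
  also have "\<bar>\<dots>\<bar> \<le> (\<Sum>i\<le>m. \<bar>coeff q i * y ^ i\<bar>)" by (rule sum_abs)
  also have "\<dots> \<le> (\<Sum>i\<le>m. \<bar>coeff q i\<bar> * R ^ i * (1 + \<bar>y\<bar> / R) ^ m)"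
  proof (rule sum_mono)
    fix i assume i: "i \<in> {..m}"
    have "\<bar>y ^ i\<bar> = R ^ i * (\<bar>y\<bar> / R) ^ i"
      using R by (simp add: power_abs power_divide)
    also have "(\<bar>y\<bar> / R) ^ i \<le> (1 + \<bar>y\<bar> / R) ^ i"
      using R by (intro power_mono) auto
    also have "\<dots> \<le> (1 + \<bar>y\<bar> / R) ^ m"
      using R i by (intro power_increasing) auto
    finally show "\<bar>coeff q i * y ^ i\<bar> \<le> \<bar>coeff q i\<bar> * R ^ i * (1 + \<bar>y\<bar> / R) ^ m"
      using R by (simp add: abs_mult mult.assoc mult_left_mono)
  qed
  also have "\<dots> = coeff_norm m R q * (1 + \<bar>y\<bar> / R) ^ m"
    by (simp add: coeff_norm_def sum_distrib_right)
  finally show ?thesis .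
qed

definition powr_log_deriv :: "real \<Rightarrow> nat \<Rightarrow> nat \<Rightarrow> real \<Rightarrow> real" where
  "powr_log_deriv \<gamma> \<mu> k x = (1 - x) powr (\<gamma> - real k) * poly (logq \<gamma> \<mu> k) (ln (1 - x))"

lemma powr_log_deriv_0: "powr_log_deriv \<gamma> \<mu> 0 x = (1 - x) powr \<gamma> * ln (1 - x) ^ \<mu>"
  by (simp add: powr_log_deriv_def poly_monom)

text \<open>The recursion of \<open>logq\<close> is the product rule with inner function ln(1 - x).
  The logarithms are unbounded near 1 and are paid for by an arbitrarily small loss \<epsilon> in
  the growth exponent.\<close>

lemma endpoint_smooth_powr_log:
  assumes "\<epsilon> > 0"
  shows "endpoint_smooth (\<gamma> - \<epsilon>) (powr_log_deriv \<gamma> \<mu>)"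
  unfolding endpoint_smooth_def
proof (intro allI conjI ballI)
  fix k and x :: real assume x: "x \<in> {-1<..<1}"
  have "((\<lambda>x. (1 - x) powr (\<gamma> - real k)) has_real_derivative
      (real k - \<gamma>) * (1 - x) powr (\<gamma> - real (Suc k))) (at x)"
    using x by (auto intro!: derivative_eq_intros simp: algebra_simps)
  moreover have "((\<lambda>x. poly (logq \<gamma> \<mu> k) (ln (1 - x))) has_real_derivative
     poly (pderiv (logq \<gamma> \<mu> k)) (ln (1 - x)) * (- 1 / (1 - x))) (at x)"
    using x by (intro DERIV_chain2[OF poly_DERIV]) (auto intro!: derivative_eq_intros)
  ultimately have "(powr_log_deriv \<gamma> \<mu> k has_real_derivative
     (real k - \<gamma>) * (1 - x) powr (\<gamma> - real (Suc k)) * poly (logq \<gamma> \<mu> k) (ln (1 - x)) +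
     poly (pderiv (logq \<gamma> \<mu> k)) (ln (1 - x)) * (- 1 / (1 - x)) * (1 - x) powr (\<gamma> - real k)) (at x)"
    unfolding powr_log_deriv_def[abs_def] by (rule DERIV_mult)
  also have "(1 - x) powr (\<gamma> - real k) = (1 - x) * (1 - x) powr (\<gamma> - real (Suc k))"
    using x powr_add[of "1 - x" 1 "\<gamma> - real (Suc k)"] by (simp add: algebra_simps)
  also have "(real k - \<gamma>) * (1 - x) powr (\<gamma> - real (Suc k)) * poly (logq \<gamma> \<mu> k) (ln (1 - x)) +
     poly (pderiv (logq \<gamma> \<mu> k)) (ln (1 - x)) * (- 1 / (1 - x)) * ((1 - x) * (1 - x) powr (\<gamma> - real (Suc k)))
     = powr_log_deriv \<gamma> \<mu> (Suc k) x"
  proof -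
    have cancel: "p * (- 1 / t) * (t * r) = - (p * r)" if "t \<noteq> 0" for p t r :: real
      using that by simp
    have "1 - x \<noteq> 0" using x by auto
    then show ?thesis
      unfolding cancel[OF \<open>1 - x \<noteq> 0\<close>] by (simp add: powr_log_deriv_def algebra_simps)
  qed
  finally show "(powr_log_deriv \<gamma> \<mu> k has_real_derivative powr_log_deriv \<gamma> \<mu> (Suc k) x) (at x)" .
next
  fix k
  obtain C where C: "C > 0" "\<And>s. s > 0 \<Longrightarrow> (1 + \<bar>ln s\<bar>) ^ \<mu> \<le> C * (s powr \<epsilon> + s powr (- \<epsilon>))"
    using one_plus_abs_ln_powr_bound[OF assms] by blast
  define N where "N = coeff_norm \<mu> 1 (logq \<gamma> \<mu> k)"
  have "\<bar>powr_log_deriv \<gamma> \<mu> k x\<bar> \<le> N * C * (2 powr (2 * \<epsilon>) + 1) * (1 - x) powr (\<gamma> - \<epsilon> - real k)"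
    if x: "x \<in> {-1<..<1}" for x
  proof -
    \<comment> \<open>As 1 - x < 2, the power with exponent \<epsilon> is absorbed into the one with
      exponent -\<epsilon>.\<close>
    have "(1 - x) powr \<epsilon> = (1 - x) powr (2 * \<epsilon>) * (1 - x) powr (- \<epsilon>)"
      by (simp flip: powr_add)
    also have "\<dots> \<le> 2 powr (2 * \<epsilon>) * (1 - x) powr (- \<epsilon>)"
      using x assms by (intro mult_right_mono powr_mono2) auto
    finally have p: "(1 - x) powr \<epsilon> + (1 - x) powr (- \<epsilon>) \<le> (2 powr (2 * \<epsilon>) + 1) * (1 - x) powr (- \<epsilon>)"
      by (simp add: algebra_simps)
    have "\<bar>poly (logq \<gamma> \<mu> k) (ln (1 - x))\<bar> \<le> N * (1 + \<bar>ln (1 - x)\<bar>) ^ \<mu>"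
      using poly_le_coeff_norm[OF zero_less_one degree_logq] by (simp add: N_def)
    also have "\<dots> \<le> N * (C * ((2 powr (2 * \<epsilon>) + 1) * (1 - x) powr (- \<epsilon>)))"
      using x C(1) p coeff_norm_nonneg[of 1]
      by (intro mult_left_mono order.trans[OF C(2)]) (auto simp: N_def)
    finally have "(1 - x) powr (\<gamma> - real k) * \<bar>poly (logq \<gamma> \<mu> k) (ln (1 - x))\<bar> \<le>
       (1 - x) powr (\<gamma> - real k) * (N * (C * ((2 powr (2 * \<epsilon>) + 1) * (1 - x) powr (- \<epsilon>))))"
      by (rule mult_left_mono) auto
    also have "\<dots> = N * C * (2 powr (2 * \<epsilon>) + 1) * ((1 - x) powr (\<gamma> - real k) * (1 - x) powr (- \<epsilon>))"
      by (simp add: mult_ac)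
    also have "(1 - x) powr (\<gamma> - real k) * (1 - x) powr (- \<epsilon>) = (1 - x) powr (\<gamma> - \<epsilon> - real k)"
      by (simp flip: powr_add add: algebra_simps)
    finally show ?thesis by (simp add: powr_log_deriv_def abs_mult)
  qed
  then show "\<exists>C. \<forall>x\<in>{-1<..<1}. \<bar>powr_log_deriv \<gamma> \<mu> k x\<bar> \<le> C * (1 - x) powr (\<gamma> - \<epsilon> - real k)"
    by blast
qed

section \<open>Moments of the logarithmic terms\<close>

text \<open>With as many integrations by parts as the degree, the polynomial becomes 1, and (1-x)^n
  from the weight cancels (1-x)^(-n) from the derivative. The integrand (1-x)^(a+\<gamma>)
  (1+x)^(b+n) q(ln(1-x)) is then studied on the scale 1 - x = s / n, where ln(1 - x) = ln s - ln
  n.\<close>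

lemma powr_log_moment_bound:
  assumes a: "a + \<gamma> > -1" and b: "b > -1" and \<mu>: "\<mu> \<ge> 1"
  obtains C N where "N \<ge> 3" "\<And>n. n \<ge> N \<Longrightarrow>
    \<bar>LBINT x:{-1<..<1}. jacobi_weight a b x * ((1 - x) powr \<gamma> * ln (1 - x) ^ \<mu>) * jacobi_poly a b n x\<bar>
      \<le> C * (real n powr (- a - 2 * \<gamma> - 2) * ln (real n) ^ (if \<gamma> \<in> \<nat> then \<mu> - 1 else \<mu>))"
proof -
  \<comment> \<open>Half of the distance to the limit of integrability, so that a + \<gamma> -
    \<epsilon> stays above -1.\<close>
  define \<epsilon> where "\<epsilon> = (a + \<gamma> + 1) / 2"
  have \<epsilon>: "\<epsilon> > 0" "a + \<gamma> - \<epsilon> > -1" using a by (auto simp: \<epsilon>_def field_simps)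
  obtain C1 where C1: "C1 > 0" "\<And>s. s > 0 \<Longrightarrow> (1 + \<bar>ln s\<bar>) ^ \<mu> \<le> C1 * (s powr \<epsilon> + s powr (- \<epsilon>))"
    using one_plus_abs_ln_powr_bound[OF \<epsilon>(1)] by blast
  obtain C2 where C2: "\<And>n. n \<ge> 1 \<Longrightarrow>
    (LBINT x:{-1<..<1}. jacobi_weight (a + \<gamma> + \<epsilon>) (b + real n) x) \<le> C2 * 2 ^ n * real n powr (- (a + \<gamma> + \<epsilon>) - 1)"
    using jacobi_weight_integral_bound[of "a + \<gamma> + \<epsilon>" b] a b \<epsilon> by auto
  obtain C3 where C3: "\<And>n. n \<ge> 1 \<Longrightarrow>
    (LBINT x:{-1<..<1}. jacobi_weight (a + \<gamma> - \<epsilon>) (b + real n) x) \<le> C3 * 2 ^ n * real n powr (- (a + \<gamma> - \<epsilon>) - 1)"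
    using jacobi_weight_integral_bound[of "a + \<gamma> - \<epsilon>" b] a b \<epsilon> by auto
  obtain C4 N where C4: "C4 > 0" "N \<ge> 3" "\<And>n. n \<ge> N \<Longrightarrow>
       (\<Prod>k<n. \<bar>real k - \<gamma>\<bar> + real \<mu> / ln (real n)) \<le>
       C4 * fact n * real n powr (- \<gamma> - 1) * (if \<gamma> \<in> \<nat> then 1 / ln (real n) else 1)"
    using prod_abs_diff_bound[of "real \<mu>" \<gamma>] by auto
  have "\<bar>LBINT x:{-1<..<1}. jacobi_weight a b x * ((1 - x) powr \<gamma> * ln (1 - x) ^ \<mu>) * jacobi_poly a b n x\<bar>
      \<le> C4 * 2 ^ \<mu> * C1 * (C2 + C3) * (real n powr (- a - 2 * \<gamma> - 2) * ln (real n) ^ (if \<gamma> \<in> \<nat> then \<mu> - 1 else \<mu>))"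
    if n: "n \<ge> N" for n
  proof -
    define R where "R = ln (real n)"
    have R: "R \<ge> 1" unfolding R_def
      using n C4(2) exp_le by (subst ln_ge_iff) (auto intro: order.trans)
    have n1: "n \<ge> 1" using n C4(2) by simp
    \<comment> \<open>The bound for the coefficient norm of q. For natural \<gamma> the factor 1 / R
      of the product bound lowers the power of R to \<mu> - 1.\<close>
    define W where "W = C4 * fact n * real n powr (- \<gamma> - 1) * R ^ (if \<gamma> \<in> \<nat> then \<mu> - 1 else \<mu>)"
    have W0: "W \<ge> 0" using C4 R by (simp add: W_def)
    have norm_W: "coeff_norm \<mu> R (logq \<gamma> \<mu> n) \<le> W"
    proof -
      have "coeff_norm \<mu> R (logq \<gamma> \<mu> n) \<le> R ^ \<mu> * (\<Prod>k<n. \<bar>real k - \<gamma>\<bar> + real \<mu> / R)"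
        using R by (intro coeff_norm_logq) auto
      also have "\<dots> \<le> R ^ \<mu> * (C4 * fact n * real n powr (- \<gamma> - 1) * (if \<gamma> \<in> \<nat> then 1 / R else 1))"
        using C4(3)[OF n] R by (intro mult_left_mono) (auto simp: R_def)
      also have "\<dots> = W"
        using \<mu> R by (cases \<mu>) (auto simp: W_def)
      finally show ?thesis .
    qed
    define h where "h x = jacobi_weight (a + real n) (b + real n) x * powr_log_deriv \<gamma> \<mu> n x" for x
    \<comment> \<open>The two summands stem from s^\<epsilon> + s^(-\<epsilon>) with s = n (1 - x):
      the powers of n come out, those of 1 - x move into the weight.\<close>
    define G where "G x = W * 2 ^ \<mu> * C1 * real n powr \<epsilon> * jacobi_weight (a + \<gamma> + \<epsilon>) (b + real n) x +
        W * 2 ^ \<mu> * C1 * real n powr (- \<epsilon>) * jacobi_weight (a + \<gamma> - \<epsilon>) (b + real n) x" for x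
    have hG: "\<bar>h x\<bar> \<le> G x" if x: "x \<in> {-1<..<1}" for x
    proof -
      define s where "s = real n * (1 - x)"
      have s: "s > 0" using x n1 by (simp add: s_def)
      have "ln (1 - x) = ln s - R"
        using x n1 by (simp add: s_def R_def ln_mult)
      \<comment> \<open>Relative to R >= 1 the logarithm is controlled by s alone, uniformly in
        n.\<close>
      then have "1 + \<bar>ln (1 - x)\<bar> / R \<le> 2 * (1 + \<bar>ln s\<bar>)"
      proof -
        have "\<bar>ln (1 - x)\<bar> / R \<le> (\<bar>ln s\<bar> + R) / R"
          using \<open>ln (1 - x) = ln s - R\<close> R by (intro divide_right_mono) auto
        also have "\<dots> \<le> \<bar>ln s\<bar> + 1"
          using R divide_left_mono[of 1 R "\<bar>ln s\<bar>"] by (simp add: add_divide_distrib)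
        finally show ?thesis by simp
      qed
      then have "(1 + \<bar>ln (1 - x)\<bar> / R) ^ \<mu> \<le> (2 * (1 + \<bar>ln s\<bar>)) ^ \<mu>"
        using R by (intro power_mono) auto
      also have "\<dots> = 2 ^ \<mu> * (1 + \<bar>ln s\<bar>) ^ \<mu>"
        by (simp only: power_mult_distrib)
      also have "\<dots> \<le> 2 ^ \<mu> * (C1 * (s powr \<epsilon> + s powr (- \<epsilon>)))"
        using C1(2)[OF s] by (intro mult_left_mono) auto
      finally have L: "(1 + \<bar>ln (1 - x)\<bar> / R) ^ \<mu> \<le> 2 ^ \<mu> * (C1 * (s powr \<epsilon> + s powr (- \<epsilon>)))" .
      have "\<bar>h x\<bar> = (1 - x) powr (a + \<gamma>) * (1 + x) powr (b + real n) * \<bar>poly (logq \<gamma> \<mu> n) (ln (1 - x))\<bar>"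
      proof -
        have "(1 - x) powr (a + \<gamma>) = (1 - x) powr (a + real n) * (1 - x) powr (\<gamma> - real n)"
          by (simp flip: powr_add)
        then show ?thesis
          by (simp add: h_def powr_log_deriv_def jacobi_weight_def abs_mult mult_ac)
      qed
      also have "\<bar>poly (logq \<gamma> \<mu> n) (ln (1 - x))\<bar> \<le> W * (2 ^ \<mu> * (C1 * (s powr \<epsilon> + s powr (- \<epsilon>))))"
      proof (rule order.trans)
        show "\<bar>poly (logq \<gamma> \<mu> n) (ln (1 - x))\<bar> \<le>
            coeff_norm \<mu> R (logq \<gamma> \<mu> n) * (1 + \<bar>ln (1 - x)\<bar> / R) ^ \<mu>"
          using R by (intro poly_le_coeff_norm degree_logq) auto
        show "\<dots> \<le> W * (2 ^ \<mu> * (C1 * (s powr \<epsilon> + s powr (- \<epsilon>))))"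
          using norm_W W0 L R by (intro mult_mono) auto
      qed
      also have "(1 - x) powr (a + \<gamma>) * (1 + x) powr (b + real n) * (W * (2 ^ \<mu> * (C1 * (s powr \<epsilon> + s powr (- \<epsilon>))))) = G x"
      proof -
        have "s powr e = real n powr e * (1 - x) powr e" for e
          using x by (simp add: s_def powr_mult)
        then show ?thesis
          by (simp add: G_def jacobi_weight_def powr_add powr_diff powr_minus divide_inverse distrib_left mult_ac)
      qed
      finally show ?thesis by (simp add: mult_left_mono)
    qed
    have iw: "set_integrable lborel {-1<..<1} (jacobi_weight (a + \<gamma> + \<epsilon>) (b + real n))"
      "set_integrable lborel {-1<..<1} (jacobi_weight (a + \<gamma> - \<epsilon>) (b + real n))"
      using a b \<epsilon> by (auto intro!: jacobi_weight_integrable)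
    have iG: "set_integrable lborel {-1<..<1} G"
      unfolding G_def[abs_def] using iw by (intro set_integral_add) auto
    have ih: "set_integrable lborel {-1<..<1} h"
    proof -
      have "set_integrable lborel {-1<..<1}
         (\<lambda>x. jacobi_weight (a + real n) (b + real n) x * powr_log_deriv \<gamma> \<mu> n x * 1)"
        using b \<epsilon> by (intro endpoint_smooth_weighted_integrable[OF _ _ endpoint_smooth_powr_log]) auto
      then show ?thesis by (simp add: h_def[abs_def])
    qed
    have "(LBINT x:{-1<..<1}. jacobi_weight a b x * ((1 - x) powr \<gamma> * ln (1 - x) ^ \<mu>) * jacobi_poly a b n x)
      = (LBINT x:{-1<..<1}. jacobi_weight a b x * powr_log_deriv \<gamma> \<mu> 0 x * jacobi_poly a b (n + 0) x)"
      by (simp add: powr_log_deriv_0)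
    also have "\<dots> = fact 0 / (2 ^ n * fact (n + 0)) *
       (LBINT x:{-1<..<1}. jacobi_weight (a + real n) (b + real n) x * powr_log_deriv \<gamma> \<mu> n x *
         jacobi_poly (a + real n) (b + real n) 0 x)"
      using \<epsilon> b by (intro jacobi_by_parts_iterated[OF _ _ endpoint_smooth_powr_log]) auto
    also have "\<dots> = 1 / (2 ^ n * fact n) * (LBINT x:{-1<..<1}. h x)"
      by (simp add: h_def jacobi_poly_def)
    finally have eq: "\<bar>LBINT x:{-1<..<1}. jacobi_weight a b x * ((1 - x) powr \<gamma> * ln (1 - x) ^ \<mu>) * jacobi_poly a b n x\<bar>
       = 1 / (2 ^ n * fact n) * \<bar>LBINT x:{-1<..<1}. h x\<bar>"
      by (simp add: abs_mult)
    have "\<bar>LBINT x:{-1<..<1}. h x\<bar> \<le> (LBINT x:{-1<..<1}. \<bar>h x\<bar>)"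
      using set_integral_norm_bound[OF ih] by simp
    also have "\<dots> \<le> (LBINT x:{-1<..<1}. G x)"
      using hG iG ih by (intro set_integral_mono set_integrable_abs) auto
    also have "\<dots> = W * 2 ^ \<mu> * C1 * real n powr \<epsilon> * (LBINT x:{-1<..<1}. jacobi_weight (a + \<gamma> + \<epsilon>) (b + real n) x) +
        W * 2 ^ \<mu> * C1 * real n powr (- \<epsilon>) * (LBINT x:{-1<..<1}. jacobi_weight (a + \<gamma> - \<epsilon>) (b + real n) x)"
      unfolding G_def using iw by (subst set_integral_add) auto
    also have "\<dots> \<le> W * 2 ^ \<mu> * C1 * real n powr \<epsilon> * (C2 * 2 ^ n * real n powr (- (a + \<gamma> + \<epsilon>) - 1)) +
        W * 2 ^ \<mu> * C1 * real n powr (- \<epsilon>) * (C3 * 2 ^ n * real n powr (- (a + \<gamma> - \<epsilon>) - 1))"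
      using C2[OF n1] C3[OF n1] W0 C1(1) by (intro add_mono mult_left_mono) auto
    also have "\<dots> = W * 2 ^ \<mu> * C1 * 2 ^ n * (C2 * (real n powr \<epsilon> * real n powr (- (a + \<gamma> + \<epsilon>) - 1)) +
        C3 * (real n powr (- \<epsilon>) * real n powr (- (a + \<gamma> - \<epsilon>) - 1)))"
      by (simp add: algebra_simps)
    \<comment> \<open>Shifting the weight exponent by \<epsilon> changes the decay by
      n^(-\<epsilon>), which exactly undoes the power of n in front. The same holds with the
      opposite sign, so both parts have the same order.\<close>
    also have "real n powr \<epsilon> * real n powr (- (a + \<gamma> + \<epsilon>) - 1) = real n powr (- a - \<gamma> - 1)"
      by (subst powr_add[symmetric], rule arg_cong2[where f = "(powr)"]) simp_all
    also have "real n powr (- \<epsilon>) * real n powr (- (a + \<gamma> - \<epsilon>) - 1) = real n powr (- a - \<gamma> - 1)"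
      by (subst powr_add[symmetric], rule arg_cong2[where f = "(powr)"]) simp_all
    finally have "1 / (2 ^ n * fact n) * \<bar>LBINT x:{-1<..<1}. h x\<bar> \<le> 1 / (2 ^ n * fact n) *
       (W * 2 ^ \<mu> * C1 * 2 ^ n * (C2 * real n powr (- a - \<gamma> - 1) + C3 * real n powr (- a - \<gamma> - 1)))"
      by (rule mult_left_mono) auto
    \<comment> \<open>The factors 2^n and n! from the integrations by parts cancel those of the
      weight integrals and of \<open>W\<close>.\<close>
    also have "\<dots> = C4 * 2 ^ \<mu> * C1 * (C2 + C3) * ((real n powr (- \<gamma> - 1) * real n powr (- a - \<gamma> - 1)) *
        R ^ (if \<gamma> \<in> \<nat> then \<mu> - 1 else \<mu>))"
      by (simp add: W_def field_simps)
    also have "real n powr (- \<gamma> - 1) * real n powr (- a - \<gamma> - 1) = real n powr (- a - 2 * \<gamma> - 2)"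
      by (subst powr_add[symmetric], rule arg_cong2[where f = "(powr)"]) simp_all
    finally show ?thesis unfolding eq R_def .
  qed
  then show ?thesis using that C4(2) by blast
qed

section \<open>The Taylor remainder and its moments\<close>

lemma endpoint_smooth_mono:
  assumes H: "endpoint_smooth c H" and "d \<le> c"
  shows "endpoint_smooth d H"
  unfolding endpoint_smooth_def
proof (intro allI conjI ballI endpoint_smooth_deriv[OF H])
  fix k
  obtain C where C: "\<And>x. x \<in> {-1<..<1} \<Longrightarrow> \<bar>H k x\<bar> \<le> C * (1 - x) powr (c - real k)"
    using endpoint_smooth_bound[OF H] by blast
  have "\<bar>H k x\<bar> \<le> \<bar>C\<bar> * 2 powr (c - d) * (1 - x) powr (d - real k)" if x: "x \<in> {-1<..<1}" for x
  proof -
    have "\<bar>H k x\<bar> \<le> \<bar>C\<bar> * ((1 - x) powr (c - d) * (1 - x) powr (d - real k))"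
      using C[OF x] mult_right_mono[OF abs_ge_self[of C], of "(1 - x) powr (c - real k)"]
      by (simp flip: powr_add)
    also have "\<dots> \<le> \<bar>C\<bar> * (2 powr (c - d) * (1 - x) powr (d - real k))"
      using x assms by (intro mult_left_mono mult_right_mono powr_mono2) auto
    finally show ?thesis by (simp add: mult.assoc)
  qed
  then show "\<exists>C. \<forall>x\<in>{-1<..<1}. \<bar>H k x\<bar> \<le> C * (1 - x) powr (d - real k)" by blast
qed

definition Leibniz :: "(nat \<Rightarrow> real \<Rightarrow> real) \<Rightarrow> (nat \<Rightarrow> real \<Rightarrow> real) \<Rightarrow> nat \<Rightarrow> real \<Rightarrow> real" where
  "Leibniz F G k x = (\<Sum>i\<le>k. real (k choose i) * (F i x * G (k - i) x))"

lemma Leibniz_deriv: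
  assumes F: "\<And>k. (F k has_real_derivative F (Suc k) x) (at x)"
    and G: "\<And>k. (G k has_real_derivative G (Suc k) x) (at x)"
  shows "(Leibniz F G k has_real_derivative Leibniz F G (Suc k) x) (at x)"
proof -
  define T where "T i j = F i x * G j x" for i j
  have "(Leibniz F G k has_real_derivative
     (\<Sum>i\<le>k. real (k choose i) * (T (Suc i) (k - i) + T i (Suc (k - i))))) (at x)"
    unfolding Leibniz_def[abs_def] T_def
    by (intro DERIV_sum DERIV_cmult DERIV_cong[OF DERIV_mult[OF F G]]) (simp add: algebra_simps)
  also have "(\<Sum>i\<le>k. real (k choose i) * (T (Suc i) (k - i) + T i (Suc (k - i)))) =
     (\<Sum>i\<le>k. real (k choose i) * T (Suc i) (k - i)) + (\<Sum>i\<le>Suc k. real (k choose i) * T i (Suc k - i))"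
    by (simp add: distrib_left sum.distrib Suc_diff_le)
  also have "(\<Sum>i\<le>Suc k. real (k choose i) * T i (Suc k - i)) =
     T 0 (Suc k) + (\<Sum>i\<le>k. real (k choose Suc i) * T (Suc i) (k - i))"
    by (subst sum.atMost_Suc_shift) simp
  also have "(\<Sum>i\<le>k. real (k choose i) * T (Suc i) (k - i)) +
     (T 0 (Suc k) + (\<Sum>i\<le>k. real (k choose Suc i) * T (Suc i) (k - i))) =
     T 0 (Suc k) + (\<Sum>i\<le>k. real (Suc k choose Suc i) * T (Suc i) (k - i))"
    by (simp add: algebra_simps sum.distrib)
  also have "\<dots> = Leibniz F G (Suc k) x"
    unfolding Leibniz_def T_def
    by (simp add: sum.atMost_Suc_shift del: sum.atMost_Suc binomial_Suc_Suc)
  finally show ?thesis .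
qed

text \<open>In every Leibniz term the exponents c - i and d - (k - i) add up to c + d - k.\<close>

lemma endpoint_smooth_Leibniz:
  assumes F: "endpoint_smooth c F" and G: "endpoint_smooth d G"
  shows "endpoint_smooth (c + d) (Leibniz F G)"
  unfolding endpoint_smooth_def
proof (intro allI conjI ballI)
  fix k x assume x: "x \<in> {-1<..<1::real}"
  show "(Leibniz F G k has_real_derivative Leibniz F G (Suc k) x) (at x)"
    by (intro Leibniz_deriv endpoint_smooth_deriv[OF F x] endpoint_smooth_deriv[OF G x])
next
  fix k
  have "\<forall>i. \<exists>C. \<forall>x\<in>{-1<..<1}. \<bar>F i x\<bar> \<le> C * (1 - x) powr (c - real i)"
       "\<forall>i. \<exists>C. \<forall>x\<in>{-1<..<1}. \<bar>G i x\<bar> \<le> C * (1 - x) powr (d - real i)"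
    using F G by (auto simp: endpoint_smooth_def)
  then obtain A B where A: "\<And>i x. x \<in> {-1<..<1} \<Longrightarrow> \<bar>F i x\<bar> \<le> A i * (1 - x) powr (c - real i)"
    and B: "\<And>i x. x \<in> {-1<..<1} \<Longrightarrow> \<bar>G i x\<bar> \<le> B i * (1 - x) powr (d - real i)"
    unfolding choice_iff by blast
  have "\<bar>Leibniz F G k x\<bar> \<le> (\<Sum>i\<le>k. real (k choose i) * (A i * B (k - i))) * (1 - x) powr (c + d - real k)"
    if x: "x \<in> {-1<..<1}" for x
  proof -
    have "\<bar>Leibniz F G k x\<bar> \<le> (\<Sum>i\<le>k. \<bar>real (k choose i) * (F i x * G (k - i) x)\<bar>)"
      unfolding Leibniz_def by (rule sum_abs)
    also have "\<dots> \<le> (\<Sum>i\<le>k. real (k choose i) * (A i * B (k - i)) * (1 - x) powr (c + d - real k))"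
    proof (rule sum_mono)
      fix i assume i: "i \<in> {..k}"
      have "\<bar>F i x\<bar> * \<bar>G (k - i) x\<bar> \<le> (A i * (1 - x) powr (c - real i)) * (B (k - i) * (1 - x) powr (d - real (k - i)))"
        using A[OF x] B[OF x] by (intro mult_mono order.trans[OF abs_ge_zero A[OF x]]) auto
      also have "\<dots> = A i * B (k - i) * ((1 - x) powr (c - real i) * (1 - x) powr (d - real (k - i)))"
        by (simp only: mult_ac)
      also have "(1 - x) powr (c - real i) * (1 - x) powr (d - real (k - i)) = (1 - x) powr (c + d - real k)"
        using i by (simp add: of_nat_diff algebra_simps flip: powr_add)
      finally show "\<bar>real (k choose i) * (F i x * G (k - i) x)\<bar> \<le>
          real (k choose i) * (A i * B (k - i)) * (1 - x) powr (c + d - real k)"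
        by (simp add: abs_mult mult.assoc mult_left_mono)
    qed
    finally show ?thesis by (simp only: sum_distrib_right)
  qed
  then show "\<exists>C. \<forall>x\<in>{-1<..<1}. \<bar>Leibniz F G k x\<bar> \<le> C * (1 - x) powr (c + d - real k)"
    by blast
qed

lemma fact_mult_power_le: "fact k * real (Suc k) ^ m \<le> fact (m + k)"
proof (induction m)
  case (Suc m)
  have "fact k * real (Suc k) ^ Suc m = real (Suc k) * (fact k * real (Suc k) ^ m)"
    by simp
  also have "\<dots> \<le> real (Suc (m + k)) * fact (m + k)"
    using Suc by (intro mult_mono) auto
  finally show ?case by simp
qed simp

section \<open>Moments of functions vanishing to high order at 1\<close>

text \<open>After m integrations by parts \<open>H m\<close> is bounded and the quotient of
  factorials supplies n^(-m). The remaining integrals are bounded uniformly in the degree through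
  |P| <= 1 + P^2, as the squared norms are bounded. The estimate is crude, but m can be chosen
  freely in the application.\<close>

lemma endpoint_smooth_moment_bigo:
  assumes a: "a > -1" and b: "b > -1" and H: "endpoint_smooth (real m) H"
  shows "(\<lambda>n. LBINT x:{-1<..<1}. jacobi_weight a b x * H 0 x * jacobi_poly a b n x)
    \<in> O(\<lambda>n. real n powr (- real m))"
proof -
  define a' b' where "a' = a + real m" and "b' = b + real m"
  have ab': "a' > -1" "b' > -1" using a b by (auto simp: a'_def b'_def)
  obtain C where C: "\<And>x. x \<in> {-1<..<1} \<Longrightarrow> \<bar>H m x\<bar> \<le> C"
    using endpoint_smooth_bound[OF H, of m] by auto
  have C0: "C \<ge> 0" using C[of 0] by auto
  define w where "w = (LBINT x:{-1<..<1}. jacobi_weight a' b' x)"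
  \<comment> \<open>The factor 1 / n turns the limit into boundedness of the norms. At index 0 the
    product is 0 and says nothing about the norm, whence k >= 1 in \<open>bound\<close>.\<close>
  have "(\<lambda>n. real n * jacobi_sigma a' b' n * (1 / real n)) \<longlonglongrightarrow> 2 powr (a' + b') * 0"
    by (intro tendsto_mult jacobi_sigma_asymp ab' lim_1_over_n)
  then have "Bseq (\<lambda>n. real n * jacobi_sigma a' b' n * (1 / real n))"
    by (intro convergent_imp_Bseq) (auto simp: convergent_def)
  then obtain S where S: "S > 0" "\<And>n. norm (real n * jacobi_sigma a' b' n * (1 / real n)) \<le> S"
    by (auto simp: Bseq_def)
  have bound: "\<bar>LBINT x:{-1<..<1}. jacobi_weight a' b' x * H m x * jacobi_poly a' b' k x\<bar> \<le> C * (w + S)"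
    if k: "k \<ge> 1" for k
  proof -
    have i1: "set_integrable lborel {-1<..<1} (\<lambda>x. jacobi_weight a' b' x * H m x * jacobi_poly a' b' k x)"
      using ab' a by (intro endpoint_smooth_weighted_integrable[OF _ _ H] continuous_on_jacobi_poly) (auto simp: a'_def)
    have i2: "set_integrable lborel {-1<..<1} (jacobi_weight a' b')"
      by (intro jacobi_weight_integrable ab')
    have i3: "set_integrable lborel {-1<..<1} (\<lambda>x. jacobi_weight a' b' x * (jacobi_poly a' b' k x)\<^sup>2)"
    proof -
      have "set_integrable lborel {-1<..<1} (\<lambda>x. jacobi_weight a' b' x * 1 * (jacobi_poly a' b' k x)\<^sup>2)"
        using ab' by (intro weighted_integrable[where c = 0 and C = 1] continuous_intros continuous_on_jacobi_poly) auto
      then show ?thesis by simp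
    qed
    have "\<bar>LBINT x:{-1<..<1}. jacobi_weight a' b' x * H m x * jacobi_poly a' b' k x\<bar>
       \<le> (LBINT x:{-1<..<1}. \<bar>jacobi_weight a' b' x * H m x * jacobi_poly a' b' k x\<bar>)"
      using set_integral_norm_bound[OF i1] by simp
    also have "\<dots> \<le> (LBINT x:{-1<..<1}. C * (jacobi_weight a' b' x + jacobi_weight a' b' x * (jacobi_poly a' b' k x)\<^sup>2))"
    proof (intro set_integral_mono set_integrable_abs i1 set_integrable_mult_right set_integral_add i2 i3)
      fix x :: real assume x: "x \<in> {-1<..<1}"
      have "\<bar>y\<bar> \<le> 1 + y\<^sup>2" for y :: real
        using zero_le_power2[of "\<bar>y\<bar> - 1"] by (simp add: power2_eq_square algebra_simps abs_mult_self_eq)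
      then have "jacobi_weight a' b' x * (\<bar>H m x\<bar> * \<bar>jacobi_poly a' b' k x\<bar>) \<le>
          jacobi_weight a' b' x * (C * (1 + (jacobi_poly a' b' k x)\<^sup>2))"
        using C[OF x] C0 by (intro mult_left_mono mult_mono jacobi_weight_nonneg) auto
      then show "\<bar>jacobi_weight a' b' x * H m x * jacobi_poly a' b' k x\<bar> \<le>
          C * (jacobi_weight a' b' x + jacobi_weight a' b' x * (jacobi_poly a' b' k x)\<^sup>2)"
        by (simp add: abs_mult jacobi_weight_nonneg algebra_simps)
    qed
    also have "\<dots> = C * (w + jacobi_sigma a' b' k)"
      using i2 i3 by (simp add: w_def jacobi_sigma_def set_integral_Icc_eq_Ioo)
    also have "jacobi_sigma a' b' k \<le> S"
      using S(2)[of k] k by simp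
    finally show ?thesis using C0 by (simp add: mult_left_mono)
  qed
  show ?thesis
  proof (rule bigoI)
    show "eventually (\<lambda>n. norm (LBINT x:{-1<..<1}. jacobi_weight a b x * H 0 x * jacobi_poly a b n x)
       \<le> C * (w + S) * real (Suc m) ^ m * norm (real n powr (- real m))) at_top"
      using eventually_ge_at_top[of "Suc m"]
    proof eventually_elim
      case (elim n)
      define k where "k = n - m"
      have n: "n = m + k" and k: "k \<ge> 1" using elim by (auto simp: k_def)
      have wS: "C * (w + S) \<ge> 0" using bound[OF k] by linarith
      have "norm (LBINT x:{-1<..<1}. jacobi_weight a b x * H 0 x * jacobi_poly a b n x) =
        fact k / (2 ^ m * fact (m + k)) *
          \<bar>LBINT x:{-1<..<1}. jacobi_weight a' b' x * H m x * jacobi_poly a' b' k x\<bar>"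
        unfolding n a'_def b'_def using a b by (subst jacobi_by_parts_iterated[OF _ _ H]) (auto simp: abs_mult)
      also have "\<dots> \<le> real (Suc m) ^ m / real n ^ m * (C * (w + S))"
      proof (intro mult_mono bound k wS)
        \<comment> \<open>The inequality n = m + k <= (k + 1) (m + 1) trades n^m for (k + 1)^m,
          which the quotient of factorials controls.\<close>
        have "real n \<le> real (Suc k) * real (Suc m)"
          by (simp add: n algebra_simps)
        then have "real n ^ m \<le> (real (Suc k) * real (Suc m)) ^ m"
          by (intro power_mono) auto
        then have "fact k * real n ^ m \<le> fact k * (real (Suc k) * real (Suc m)) ^ m"
          by (intro mult_left_mono) auto
        also have "\<dots> = fact k * real (Suc k) ^ m * real (Suc m) ^ m"
          by (simp only: power_mult_distrib mult_ac)
        also have "\<dots> \<le> fact (m + k) * real (Suc m) ^ m"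
          by (intro mult_right_mono fact_mult_power_le) auto
        finally have 1: "fact k * real n ^ m \<le> real (Suc m) ^ m * fact (m + k)"
          by (simp only: mult_ac)
        have "fact k / (2 ^ m * fact (m + k)) \<le> fact k / (1 * fact (m + k) :: real)"
          by (intro divide_left_mono mult_right_mono) auto
        also have "\<dots> \<le> real (Suc m) ^ m / real n ^ m"
          using 1 k by (simp add: field_simps n)
        finally show "fact k / (2 ^ m * fact (m + k)) \<le> real (Suc m) ^ m / real n ^ m" .
      qed auto
      also have "\<dots> = C * (w + S) * real (Suc m) ^ m * norm (real n powr (- real m))"
        using elim by (simp add: powr_minus powr_realpow field_simps)
      finally show ?case .
    qed
  qed
qed

section \<open>The Taylor remainder at 1\<close>

text \<open>When \<open>D\<close> lists the derivatives of a function, this is the j-th derivative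
  of its remainder after K terms. Truncated subtraction makes the sum empty for j >= K, so the
  sequence simply continues with \<open>D j\<close>.\<close>

definition Taylor_rem :: "(nat \<Rightarrow> real \<Rightarrow> real) \<Rightarrow> nat \<Rightarrow> nat \<Rightarrow> real \<Rightarrow> real" where
  "Taylor_rem D K j x = D j x - (\<Sum>i<K - j. D (j + i) 1 / fact i * (x - 1) ^ i)"

lemma Taylor_rem_deriv:
  assumes "(D j has_real_derivative D (Suc j) x) (at x within S)"
  shows "(Taylor_rem D K j has_real_derivative Taylor_rem D K (Suc j) x) (at x within S)"
proof -
  have "((\<lambda>x. \<Sum>i<K - j. D (j + i) 1 / fact i * (x - 1) ^ i) has_real_derivative
     (\<Sum>i<K - j. D (j + i) 1 / fact i * (real i * (x - 1) ^ (i - 1)))) (at x within S)"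
    by (intro DERIV_sum DERIV_cmult) (auto intro!: derivative_eq_intros)
  also have "(\<Sum>i<K - j. D (j + i) 1 / fact i * (real i * (x - 1) ^ (i - 1))) =
     (\<Sum>i<K - Suc j. D (Suc j + i) 1 / fact i * (x - 1) ^ i)"
  proof (cases "K - j")
    case 0
    then show ?thesis by simp
  next
    case (Suc l)
    then have l: "K - Suc j = l" by simp
    have "c / fact (Suc i) * (real (Suc i) * p) = c / fact i * p" for c p :: real and i
      by (simp add: fact_Suc field_simps del: of_nat_Suc)
    then show ?thesis unfolding Suc l
      by (subst sum.lessThan_Suc_shift) simp
  qed
  finally show ?thesis
    unfolding Taylor_rem_def[abs_def] by (intro DERIV_diff assms)
qed

text \<open>For j < K the j-th derivative of the remainder vanishes at 1, so by the mean value
  theorem it vanishes to one order more than the next derivative. The induction runs downward from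
  order K, where boundedness is enough; beyond K the exponent is negative and boundedness is enough
  again.\<close>

lemma endpoint_smooth_Taylor_rem:
  assumes D: "\<And>k x. x \<in> {-1..1} \<Longrightarrow> (D k has_real_derivative D (Suc k) x) (at x within {-1..1})"
  shows "endpoint_smooth (real K) (Taylor_rem D K)"
proof -
  let ?T = "Taylor_rem D K"
  have T: "(?T k has_real_derivative ?T (Suc k) x) (at x within {-1..1})" if "x \<in> {-1..1}" for k x
    using D[OF that] by (rule Taylor_rem_deriv)
  have Tin: "(?T k has_real_derivative ?T (Suc k) x) (at x)" if x: "x \<in> {-1<..<1}" for k x
    using T[of x k] x at_within_interior[of x "{-1..1}"] by simp
  have cont: "continuous_on {-1..1} (?T k)" for k
    by (rule DERIV_continuous_on) (rule T)
  have bounded: "\<exists>B. \<forall>x\<in>{-1..1}. \<bar>?T k x\<bar> \<le> B" for k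
  proof -
    obtain B where "\<forall>y\<in>?T k ` {-1..1}. norm y \<le> B"
      using compact_imp_bounded[OF compact_continuous_image[OF cont[of k] compact_Icc]]
      by (auto simp: bounded_iff)
    then show ?thesis by (intro exI[of _ B]) auto
  qed
  have small: "\<exists>B. \<forall>x\<in>{-1..1}. \<bar>?T (K - l) x\<bar> \<le> B * (1 - x) ^ l" if "l \<le> K" for l
    using that
  proof (induction l)
    case 0
    then show ?case using bounded by simp
  next
    case (Suc l)
    then obtain B where B: "\<And>x. x \<in> {-1..1} \<Longrightarrow> \<bar>?T (K - l) x\<bar> \<le> B * (1 - x) ^ l"
      by (meson Suc_leD)
    define j where "j = K - Suc l"
    have j: "K - l = Suc j" "K - j = Suc l" using Suc.prems by (auto simp: j_def)
    have B0: "B \<ge> 0" using B[of 0] by (auto intro: order.trans[OF abs_ge_zero])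
    \<comment> \<open>K - j = l + 1 is positive, so the sum contains the constant term
      \<open>D j 1\<close>; all its other terms vanish at 1.\<close>
    have T1: "?T j 1 = 0" unfolding Taylor_rem_def j(2) by (subst sum.lessThan_Suc_shift) simp
    have "\<bar>?T j x\<bar> \<le> B * (1 - x) ^ Suc l" if x: "x \<in> {-1..1}" for x
    proof (cases "x = 1")
      case True
      then show ?thesis using T1 by simp
    next
      case False
      then have x1: "x < 1" using x by simp
      have "continuous_on {x..1} (?T j)"
        using x by (intro continuous_on_subset[OF cont]) auto
      then obtain d y where y: "x < y" "y < 1" "(?T j has_real_derivative d) (at y)" "?T j 1 - ?T j x = (1 - x) * d"
        using MVT[OF x1] Tin[of _ j] x by (force simp: real_differentiable_def)
      have "d = ?T (Suc j) y"
        using y x by (intro DERIV_unique[OF y(3) Tin]) auto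
      note y = y(1,2) y(4)[unfolded this]
      have "\<bar>?T j x\<bar> = (1 - x) * \<bar>?T (Suc j) y\<bar>"
        using y(3) T1 x1 by (metis abs_minus_cancel abs_mult abs_of_pos diff_0 diff_gt_0_iff_gt)
      also have "\<dots> \<le> (1 - x) * (B * (1 - y) ^ l)"
        using B[of y] y x unfolding j(1) by (intro mult_left_mono) auto
      also have "\<dots> \<le> (1 - x) * (B * (1 - x) ^ l)"
        using y x B0 by (intro mult_left_mono power_mono) auto
      finally show ?thesis by (simp add: mult_ac)
    qed
    then show ?case unfolding j_def by blast
  qed
  show ?thesis
    unfolding endpoint_smooth_def
  proof (intro allI conjI ballI Tin)
    fix k
    show "\<exists>C. \<forall>x\<in>{-1<..<1}. \<bar>?T k x\<bar> \<le> C * (1 - x) powr (real K - real k)"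
    proof (cases "k \<le> K")
      case True
      obtain B where B: "\<forall>x\<in>{-1..1}. \<bar>?T (K - (K - k)) x\<bar> \<le> B * (1 - x) ^ (K - k)"
        using small[of "K - k"] by auto
      show ?thesis
      proof (intro exI ballI)
        fix x :: real assume x: "x \<in> {-1<..<1}"
        have "(1 - x) ^ (K - k) = (1 - x) powr (real K - real k)"
          using x True by (simp add: powr_realpow of_nat_diff flip: of_nat_diff)
        then show "\<bar>?T k x\<bar> \<le> B * (1 - x) powr (real K - real k)"
          using bspec[OF B, of x] x True by auto
      qed
    next
      case False
      obtain B where B: "\<forall>x\<in>{-1..1}. \<bar>?T k x\<bar> \<le> B" using bounded by blast
      show ?thesis
      proof (intro exI ballI)
        fix x :: real assume x: "x \<in> {-1<..<1}"
        have "1 = 2 powr (real k - real K) * 2 powr (real K - real k)"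
          by (simp flip: powr_add)
        also have "\<dots> \<le> 2 powr (real k - real K) * (1 - x) powr (real K - real k)"
          using x False by (intro mult_left_mono powr_mono2') auto
        finally have "\<bar>?T k x\<bar> * 1 \<le> B * (2 powr (real k - real K) * (1 - x) powr (real K - real k))"
          using bspec[OF B, of x] x by (intro mult_mono) auto
        then show "\<bar>?T k x\<bar> \<le> B * 2 powr (real k - real K) * (1 - x) powr (real K - real k)"
          by (simp add: mult.assoc)
      qed
    qed
  qed
qed

section \<open>Jacobi coefficients\<close>

lemma powr_log_moment_bigo:
  assumes "a + \<gamma> > -1" "b > -1" "\<mu> \<ge> 1"
  shows "(\<lambda>n. LBINT x:{-1<..<1}. jacobi_weight a b x * ((1 - x) powr \<gamma> * ln (1 - x) ^ \<mu>) * jacobi_poly a b n x)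
    \<in> O(\<lambda>n. real n powr (- a - 2 * \<gamma> - 2) * ln (real n) ^ (if \<gamma> \<in> \<nat> then \<mu> - 1 else \<mu>))"
proof -
  obtain C N where C: "N \<ge> 3" "\<And>n. n \<ge> N \<Longrightarrow>
    \<bar>LBINT x:{-1<..<1}. jacobi_weight a b x * ((1 - x) powr \<gamma> * ln (1 - x) ^ \<mu>) * jacobi_poly a b n x\<bar>
      \<le> C * (real n powr (- a - 2 * \<gamma> - 2) * ln (real n) ^ (if \<gamma> \<in> \<nat> then \<mu> - 1 else \<mu>))"
    using powr_log_moment_bound[OF assms] by blast
  show ?thesis
  proof (rule bigoI)
    show "eventually (\<lambda>n. norm (LBINT x:{-1<..<1}. jacobi_weight a b x * ((1 - x) powr \<gamma> * ln (1 - x) ^ \<mu>) * jacobi_poly a b n x)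
      \<le> C * norm (real n powr (- a - 2 * \<gamma> - 2) * ln (real n) ^ (if \<gamma> \<in> \<nat> then \<mu> - 1 else \<mu>))) at_top"
      using eventually_ge_at_top[of N]
    proof eventually_elim
      case (elim n)
      then have "ln (real n) \<ge> 0" using C(1) by auto
      then show ?case using C(2)[OF elim] by (simp add: abs_mult)
    qed
  qed
qed

lemma
  fixes f :: "'i \<Rightarrow> 'a \<Rightarrow> real"
  assumes "\<And>i. i \<in> I \<Longrightarrow> set_integrable M A (f i)"
  shows set_integrable_sum: "set_integrable M A (\<lambda>x. \<Sum>i\<in>I. f i x)"
    and set_integral_sum: "(LINT x:A|M. \<Sum>i\<in>I. f i x) = (\<Sum>i\<in>I. LINT x:A|M. f i x)"
  using assms unfolding set_integrable_def set_lebesgue_integral_def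
  by (simp_all add: sum_distrib_left)

text \<open>Expanding g at 1 in powers of 1 - x gives terms with \<gamma> + i in place of \<gamma>,
  handled by \<open>powr_log_moment_bigo\<close>, and the singular factor times the Taylor
  remainder, handled by \<open>endpoint_smooth_moment_bigo\<close>.\<close>

lemma jacobi_moment_bigo:
  assumes a: "\<alpha> > -1" and b: "\<beta> > -1" and \<mu>: "\<mu> \<ge> 1" and ag: "\<alpha> + \<gamma> > -1"
    and g: "C_infinity_on {-1..1} g"
  shows "(\<lambda>n. LBINT x:{-1<..<1}. jacobi_weight \<alpha> \<beta> x * ((1 - x) powr \<gamma> * ln (1 - x) ^ \<mu> * g x) * jacobi_poly \<alpha> \<beta> n x)
    \<in> O(\<lambda>n. real n powr (- \<alpha> - 2 * \<gamma> - 2) * ln (real n) ^ (if \<gamma> \<in> \<nat> then \<mu> - 1 else \<mu>))"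
    (is "_ \<in> O(?E)")
proof -
  obtain D where D0: "\<And>x. x \<in> {-1..1} \<Longrightarrow> D 0 x = g x"
    and D: "\<And>k x. x \<in> {-1..1} \<Longrightarrow> (D k has_real_derivative D (Suc k) x) (at x within {-1..1})"
    using g unfolding C_infinity_on_def by metis
  define \<epsilon> where "\<epsilon> = (\<alpha> + \<gamma> + 1) / 2"
  have \<epsilon>: "\<epsilon> > 0" "\<alpha> + (\<gamma> - \<epsilon>) > -1" using ag by (auto simp: \<epsilon>_def field_simps)
  \<comment> \<open>Large enough that n^(-m) is within the claimed rate.\<close>
  define m where "m = nat \<lceil>\<bar>\<alpha> + 2 * \<gamma> + 2\<bar>\<rceil>"
  have m: "real m \<ge> \<alpha> + 2 * \<gamma> + 2" unfolding m_def by linarith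
  \<comment> \<open>Large enough that the singular factor, of growth exponent \<gamma> - \<epsilon>,
    times the remainder vanishes to order m at 1.\<close>
  define K where "K = m + nat \<lceil>\<bar>\<gamma> - \<epsilon>\<bar>\<rceil>"
  have K: "(\<gamma> - \<epsilon>) + real K \<ge> real m" unfolding K_def by simp linarith
  define c where "c i = (-1) ^ i * D i 1 / fact i" for i
  define L where "L i = powr_log_deriv (\<gamma> + real i) \<mu> 0" for i
  define H where "H = Leibniz (powr_log_deriv \<gamma> \<mu>) (Taylor_rem D K)"
  have "endpoint_smooth (real K) (Taylor_rem D K)"
    by (rule endpoint_smooth_Taylor_rem) (rule D)
  from endpoint_smooth_Leibniz[OF endpoint_smooth_powr_log[OF \<epsilon>(1)] this] K
  have H: "endpoint_smooth (real m) H"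
    unfolding H_def by (rule endpoint_smooth_mono)
  have split: "(1 - x) powr \<gamma> * ln (1 - x) ^ \<mu> * g x = (\<Sum>i<K. c i * L i x) + H 0 x"
    if x: "x \<in> {-1<..<1}" for x
  proof -
    have "g x = Taylor_rem D K 0 x + (\<Sum>i<K. c i * (1 - x) ^ i)"
    proof -
      have "(x - 1) ^ i = (-1) ^ i * (1 - x) ^ i" for i
        by (metis minus_diff_eq mult_minus1 power_mult_distrib)
      then show ?thesis
        using x by (simp add: Taylor_rem_def D0 c_def mult_ac)
    qed
    moreover have "L i x = (1 - x) powr \<gamma> * ln (1 - x) ^ \<mu> * (1 - x) ^ i" for i
      using x by (simp add: L_def powr_log_deriv_0 powr_add powr_realpow)
    ultimately show ?thesis
      by (simp add: H_def Leibniz_def powr_log_deriv_0 algebra_simps sum_distrib_left)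
  qed
  have intL: "set_integrable lborel {-1<..<1} (\<lambda>x. jacobi_weight \<alpha> \<beta> x * L i x * jacobi_poly \<alpha> \<beta> n x)" for i n
    unfolding L_def using \<epsilon> b
    by (intro endpoint_smooth_weighted_integrable[OF _ _ endpoint_smooth_powr_log[OF \<epsilon>(1)]] continuous_on_jacobi_poly) auto
  have intH: "set_integrable lborel {-1<..<1} (\<lambda>x. jacobi_weight \<alpha> \<beta> x * H 0 x * jacobi_poly \<alpha> \<beta> n x)" for n
    using a b by (intro endpoint_smooth_weighted_integrable[OF _ _ H] continuous_on_jacobi_poly) auto
  have eq: "(LBINT x:{-1<..<1}. jacobi_weight \<alpha> \<beta> x * ((1 - x) powr \<gamma> * ln (1 - x) ^ \<mu> * g x) * jacobi_poly \<alpha> \<beta> n x)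
     = (\<Sum>i<K. c i * (LBINT x:{-1<..<1}. jacobi_weight \<alpha> \<beta> x * L i x * jacobi_poly \<alpha> \<beta> n x)) +
       (LBINT x:{-1<..<1}. jacobi_weight \<alpha> \<beta> x * H 0 x * jacobi_poly \<alpha> \<beta> n x)" (is "?l = ?r") for n
  proof -
    have "?l = (LBINT x:{-1<..<1}. (\<Sum>i<K. c i * (jacobi_weight \<alpha> \<beta> x * L i x * jacobi_poly \<alpha> \<beta> n x)) +
       jacobi_weight \<alpha> \<beta> x * H 0 x * jacobi_poly \<alpha> \<beta> n x)"
    proof (intro set_lebesgue_integral_cong allI impI)
      fix x :: real assume x: "x \<in> {-1<..<1}"
      show "jacobi_weight \<alpha> \<beta> x * ((1 - x) powr \<gamma> * ln (1 - x) ^ \<mu> * g x) * jacobi_poly \<alpha> \<beta> n x =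
        (\<Sum>i<K. c i * (jacobi_weight \<alpha> \<beta> x * L i x * jacobi_poly \<alpha> \<beta> n x)) +
         jacobi_weight \<alpha> \<beta> x * H 0 x * jacobi_poly \<alpha> \<beta> n x"
        unfolding split[OF x] by (simp add: algebra_simps sum_distrib_left)
    qed auto
    also have "\<dots> = ?r"
      using intL intH
      by (subst set_integral_add) (auto simp: set_integral_sum intro!: set_integrable_sum)
    finally show ?thesis .
  qed
  have ln_ge: "eventually (\<lambda>n. ln (real n) \<ge> 1) at_top" by real_asymp
  have bigoL: "(\<lambda>n. c i * (LBINT x:{-1<..<1}. jacobi_weight \<alpha> \<beta> x * L i x * jacobi_poly \<alpha> \<beta> n x)) \<in> O(?E)" for i
  proof -
    have "(\<lambda>n. LBINT x:{-1<..<1}. jacobi_weight \<alpha> \<beta> x * L i x * jacobi_poly \<alpha> \<beta> n x) \<in>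
      O(\<lambda>n. real n powr (- \<alpha> - 2 * (\<gamma> + real i) - 2) * ln (real n) ^ (if \<gamma> + real i \<in> \<nat> then \<mu> - 1 else \<mu>))"
      unfolding L_def powr_log_deriv_0 using ag b \<mu> by (intro powr_log_moment_bigo) auto
    also have "(\<lambda>n. real n powr (- \<alpha> - 2 * (\<gamma> + real i) - 2) * ln (real n) ^ (if \<gamma> + real i \<in> \<nat> then \<mu> - 1 else \<mu>)) \<in> O(?E)"
    proof (rule bigoI)
      show "eventually (\<lambda>n. norm (real n powr (- \<alpha> - 2 * (\<gamma> + real i) - 2) * ln (real n) ^ (if \<gamma> + real i \<in> \<nat> then \<mu> - 1 else \<mu>))
         \<le> 1 * norm (?E n)) at_top"
        using ln_ge eventually_ge_at_top[of 1]
      proof eventually_elim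
        case (elim n)
        \<comment> \<open>If \<gamma> is natural, so is \<gamma> + i; hence no later term carries
          more logarithms than the leading one.\<close>
        have "(if \<gamma> + real i \<in> \<nat> then \<mu> - 1 else \<mu>) \<le> (if \<gamma> \<in> \<nat> then \<mu> - 1 else \<mu>)"
          by auto
        then have "real n powr (- \<alpha> - 2 * (\<gamma> + real i) - 2) * ln (real n) ^ (if \<gamma> + real i \<in> \<nat> then \<mu> - 1 else \<mu>) \<le> ?E n"
          using elim by (intro mult_mono powr_mono power_increasing) auto
        then show ?case using elim by (simp add: abs_mult)
      qed
    qed
    finally show ?thesis by simp
  qed
  have bigoH: "(\<lambda>n. LBINT x:{-1<..<1}. jacobi_weight \<alpha> \<beta> x * H 0 x * jacobi_poly \<alpha> \<beta> n x) \<in> O(?E)"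
  proof -
    note endpoint_smooth_moment_bigo[OF a b H]
    also have "(\<lambda>n. real n powr (- real m)) \<in> O(?E)"
    proof (rule bigoI)
      show "eventually (\<lambda>n. norm (real n powr (- real m)) \<le> 1 * norm (?E n)) at_top"
        using ln_ge eventually_ge_at_top[of 1]
      proof eventually_elim
        case (elim n)
        have "real n powr (- real m) * 1 \<le> ?E n"
          using elim m by (intro mult_mono powr_mono one_le_power) auto
        then show ?case using elim by (simp add: abs_mult)
      qed
    qed
    finally show ?thesis .
  qed
  show ?thesis
    unfolding eq using bigoL bigoH by (intro sum_in_bigo big_sum_in_bigo) auto
qed

text \<open>The norms are of exact order 1/n, so dividing by them adds 1 to the exponent of n in the
  moment bound. The argument saves a logarithm only when some factor k - \<gamma> with k >= 0
  vanishes; negative integers \<gamma> therefore share the bound of the non-integers.\<close>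

theorem theorem1:
  fixes \<alpha> \<beta> \<gamma> :: real and \<mu> :: nat and f g :: "real \<Rightarrow> real"
  assumes "\<alpha> > -1" and "\<beta> > -1"
    and "\<mu> \<ge> 1"
    and "\<alpha> + \<gamma> > -1"
    and "C_infinity_on {-1..1} g"
    and "\<And>x. x \<in> {-1..<1} \<Longrightarrow> f x = (1 - x) powr \<gamma> * ln (1 - x) ^ \<mu> * g x"
  shows "(\<gamma> \<notin> \<int> \<longrightarrow>
            (\<lambda>n. \<bar>jacobi_coeff \<alpha> \<beta> f n\<bar>)
              \<in> O(\<lambda>n. real n powr (- \<alpha> - 2 * \<gamma> - 1) * ln (real n) ^ \<mu>)) \<and>
         (\<gamma> \<in> \<int> \<and> \<gamma> \<ge> 0 \<longrightarrow>
            (\<lambda>n. \<bar>jacobi_coeff \<alpha> \<beta> f n\<bar>)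
              \<in> O(\<lambda>n. real n powr (- \<alpha> - 2 * \<gamma> - 1) * ln (real n) ^ (\<mu> - 1))) \<and>
         (\<gamma> \<in> \<int> \<and> \<gamma> < 0 \<longrightarrow>
            (\<lambda>n. \<bar>jacobi_coeff \<alpha> \<beta> f n\<bar>)
              \<in> O(\<lambda>n. real n powr (- \<alpha> - 2 * \<gamma> - 1) * ln (real n) ^ \<mu>))"
proof -
  define e where "e = (if \<gamma> \<in> \<nat> then \<mu> - 1 else \<mu>)"
  define J where "J n = (LBINT x:{-1<..<1}. jacobi_weight \<alpha> \<beta> x *
      ((1 - x) powr \<gamma> * ln (1 - x) ^ \<mu> * g x) * jacobi_poly \<alpha> \<beta> n x)" for n
  \<comment> \<open>Passing to the open interval discards x = 1, where nothing is assumed about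
    \<open>f\<close>.\<close>
  have "(LBINT x:{-1..1}. jacobi_weight \<alpha> \<beta> x * f x * jacobi_poly \<alpha> \<beta> n x) = J n" for n
    unfolding set_integral_Icc_eq_Ioo J_def
    using assms(6) by (intro set_lebesgue_integral_cong) auto
  then have coeff: "jacobi_coeff \<alpha> \<beta> f n = 1 / jacobi_sigma \<alpha> \<beta> n * J n" for n
    by (simp add: jacobi_coeff_def)
  have sigma: "(\<lambda>n. 1 / jacobi_sigma \<alpha> \<beta> n) \<in> O(\<lambda>n. real n)"
  proof (rule bigoI_tendsto)
    show "(\<lambda>n. 1 / jacobi_sigma \<alpha> \<beta> n / real n) \<longlonglongrightarrow> 1 / 2 powr (\<alpha> + \<beta>)"
      using tendsto_divide[OF tendsto_const[of 1] jacobi_sigma_asymp[OF assms(1,2)]]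
      by (simp add: mult.commute)
    show "eventually (\<lambda>n. real n \<noteq> 0) at_top"
      using eventually_gt_at_top[of 0] by eventually_elim simp
  qed
  have "(\<lambda>n. \<bar>jacobi_coeff \<alpha> \<beta> f n\<bar>) \<in>
      O(\<lambda>n. real n * (real n powr (- \<alpha> - 2 * \<gamma> - 2) * ln (real n) ^ e))"
    unfolding coeff landau_o.big.abs_in_iff J_def e_def
    using assms(1-5) by (intro landau_o.big.mult sigma jacobi_moment_bigo)
  also have "(\<lambda>n. real n * (real n powr (- \<alpha> - 2 * \<gamma> - 2) * ln (real n) ^ e)) =
      (\<lambda>n. real n powr (- \<alpha> - 2 * \<gamma> - 1) * ln (real n) ^ e)"
  proof
    fix n
    have "real n * real n powr (- \<alpha> - 2 * \<gamma> - 2) = real n powr (- \<alpha> - 2 * \<gamma> - 1)"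
      using powr_mult_base[of "real n" "- \<alpha> - 2 * \<gamma> - 2"] by (cases "n = 0") auto
    then show "real n * (real n powr (- \<alpha> - 2 * \<gamma> - 2) * ln (real n) ^ e) =
       real n powr (- \<alpha> - 2 * \<gamma> - 1) * ln (real n) ^ e"
      by (simp flip: mult.assoc)
  qed
  finally have *: "(\<lambda>n. \<bar>jacobi_coeff \<alpha> \<beta> f n\<bar>) \<in>
      O(\<lambda>n. real n powr (- \<alpha> - 2 * \<gamma> - 1) * ln (real n) ^ e)" .
  \<comment> \<open>Thus \<open>e\<close> is \<mu> - 1 in the second case and \<mu> in the first and
    third.\<close>
  have "\<gamma> \<in> \<nat> \<longleftrightarrow> \<gamma> \<in> \<int> \<and> \<gamma> \<ge> 0"
    by (auto simp: Nats_altdef2 Nats_subset_Ints)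
  then show ?thesis using * by (auto simp: e_def)
qed

end
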